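(* There is a reduction that, given an R-CSP instance $\Pi$ whose constraint graph $G$ is $3$-regular and an integer $F\in\{1,\dots,|V(G)|\}$, returns in time $|\Pi|^{O(1)}$ an instance $\mathcal{I}(\Pi,F)=(I,p,c,B)$ of $d$-dimensional knapsack such that the following holds. 1. The number of dimensions is $d=2\cdot\left\lceil\frac{|V(G)|+|E(G)|}{F}\right\rceil$. 2. $|\mathcal{I}(\Pi,F)|=O(|\Pi|^4)$. 3. (Completeness) If $\mathrm{Par}(\Pi)=|V(G)|$, then there is a solution for $\mathcal{I}(\Pi,F)$ with profit $|V(G)|+2\cdot|E(G)|$. 4. (Soundness) For every $q\in\mathbb{N}$, if there is a solution for $\mathcal{I}(\Pi,F)$ of profit at least $|V(G)|+2\cdot|E(G)|-q$, then $\mathrm{Par}(\Pi)\ge|V(G)|-2\cdot q\cdot F$.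
   Context: R-CSP (2-CSP with rectangular constraints): an instance $\Pi=\left(G,\Sigma,\Upsilon,\{\pi_{e,u},\pi_{e,v}\}_{e=(u,v)\in E(G)}\right)$ consists of a constraint graph $G$, alphabets $\Sigma$ and $\Upsilon=\{1,\dots,m\}$ for some integer $m\ge1$, and for each edge $e=(u,v)\in E(G)$ two functions $\pi_{e,u},\pi_{e,v}:\Sigma\to\Upsilon$. A partial assignment is a function $\varphi:V(G)\to\Sigma\cup\{\perp\}$ (with $\perp\notin\Sigma$). It is consistent if for every $e=(u,v)\in E(G)$ with $\varphi(u)\ne\perp$ and $\varphi(v)\ne\perp$ we have $\pi_{e,u}(\varphi(u))=\pi_{e,v}(\varphi(v))$. Its size is $|\varphi|=|\{v\in V(G):\varphi(v)\ne\perp\}|$. $\mathrm{Par}(\Pi)$ is the maximum size of a consistent partial assignment. Graphs are simple, with each edge given one fixed orientation (edges $(u,v)$ are oriented so that $u$ precedes $v$ in a fixed total order of the vertices); a graph is $3$-regular if every vertex has exactly three adjacent edges (ignoring orientation). $d$-dimensional knapsack: an instance $(I,p,c,B)$ consists of a finite set of items $I$, a profit function $p: I\to\mathbb{N}$, a cost function $c: I\to \mathbb{N}^d$, and a budget $B\in\mathbb{N}^d$ (here $0\in\mathbb{N}$). A solution is a subset $S\subseteq I$ with $\sum_{i\in S}c_j(i)\le B_j$ for all $j\in\{1,\dots,d\}$; its profit is $p(S)=\sum_{i\in S}p(i)$. $|\cdot|$ applied to an instance denotes its encoding size, with the sets and functions of $\Pi$ listed explicitly and the numbers of the knapsack instance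 written in binary. *)

theory Defs
  imports Complex_Main
begin

section \<open>R-CSP\<close>

text \<open>
  The constraint graph is given by \<open>verts\<close> and \<open>edges\<close>, the alphabet \<open>\<Upsilon>\<close> is \<open>{1..ups}\<close>, and
  \<open>proj \<Pi> e u\<close> is the map \<open>\<pi>\<^bsub>e,u\<^esub>\<close>; it is only relevant for \<open>e \<in> edges \<Pi>\<close>, \<open>u\<close> an endpoint of
  \<open>e\<close>, and arguments in \<open>sigma \<Pi>\<close>.
\<close>

record ('v, 'a) rcsp =
  verts :: "'v set"
  edges :: "('v \<times> 'v) set"
  sigma :: "'a set"
  ups :: nat
  proj :: "'v \<times> 'v \<Rightarrow> 'v \<Rightarrow> 'a \<Rightarrow> nat"

text \<open>The graph is simple; each edge is stored once, oriented along the order of the vertices.\<close>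

definition is_rcsp :: "('v::linorder, 'a) rcsp \<Rightarrow> bool" where
  "is_rcsp \<Pi> \<longleftrightarrow>
     finite (verts \<Pi>) \<and> finite (sigma \<Pi>) \<and> ups \<Pi> \<ge> 1 \<and>
     (\<forall>(u, v) \<in> edges \<Pi>. u \<in> verts \<Pi> \<and> v \<in> verts \<Pi> \<and> u < v) \<and>
     (\<forall>(u, v) \<in> edges \<Pi>. \<forall>x \<in> sigma \<Pi>.
        proj \<Pi> (u, v) u x \<in> {1..ups \<Pi>} \<and> proj \<Pi> (u, v) v x \<in> {1..ups \<Pi>})"

definition neighbours :: "('v, 'a) rcsp \<Rightarrow> 'v \<Rightarrow> 'v set" where
  "neighbours \<Pi> v = {u \<in> verts \<Pi>. (u, v) \<in> edges \<Pi> \<or> (v, u) \<in> edges \<Pi>}"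

definition regular :: "nat \<Rightarrow> ('v, 'a) rcsp \<Rightarrow> bool" where
  "regular k \<Pi> \<longleftrightarrow> (\<forall>v \<in> verts \<Pi>. card (neighbours \<Pi> v) = k)"

text \<open>The value \<open>None\<close> plays the role of \<open>\<bottom>\<close>.\<close>

definition partial_assignment :: "('v, 'a) rcsp \<Rightarrow> ('v \<rightharpoonup> 'a) \<Rightarrow> bool" where
  "partial_assignment \<Pi> \<phi> \<longleftrightarrow> dom \<phi> \<subseteq> verts \<Pi> \<and> ran \<phi> \<subseteq> sigma \<Pi>"

definition consistent :: "('v, 'a) rcsp \<Rightarrow> ('v \<rightharpoonup> 'a) \<Rightarrow> bool" where
  "consistent \<Pi> \<phi> \<longleftrightarrow>
     (\<forall>(u, v) \<in> edges \<Pi>. \<phi> u \<noteq> None \<and> \<phi> v \<noteq> None \<longrightarrow>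
        proj \<Pi> (u, v) u (the (\<phi> u)) = proj \<Pi> (u, v) v (the (\<phi> v)))"

definition Par :: "('v, 'a) rcsp \<Rightarrow> nat" where
  "Par \<Pi> = Max {card (dom \<phi>) | \<phi>. partial_assignment \<Pi> \<phi> \<and> consistent \<Pi> \<phi>}"


section \<open>Multidimensional knapsack\<close>

text \<open>Vectors in \<open>\<nat>\<^sup>d\<close> are functions of which only the values at \<open>1, \<dots>, d\<close> matter.\<close>

record 'i knapsack =
  items :: "'i set"
  profit :: "'i \<Rightarrow> nat"
  dim :: nat
  cost :: "'i \<Rightarrow> nat \<Rightarrow> nat"
  budget :: "nat \<Rightarrow> nat"

definition is_knapsack :: "'i knapsack \<Rightarrow> bool" where
  "is_knapsack K \<longleftrightarrow> finite (items K)"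

definition is_solution :: "'i knapsack \<Rightarrow> 'i set \<Rightarrow> bool" where
  "is_solution K S \<longleftrightarrow> S \<subseteq> items K \<and> (\<forall>j \<in> {1..dim K}. (\<Sum>i\<in>S. cost K i j) \<le> budget K j)"

definition total_profit :: "'i knapsack \<Rightarrow> 'i set \<Rightarrow> nat" where
  "total_profit K S = (\<Sum>i\<in>S. profit K i)"


section \<open>Encodings\<close>

text \<open>
  For the purpose of encoding, vertices, symbols of \<open>\<Sigma>\<close> and items are named by natural numbers.
  An instance is written as a sequence of numbers in binary, most significant digit first, each
  terminated by \<open>Sep\<close>. Lengths of lists precede the lists, which makes the encodings uniquely
  decodable.
\<close>

datatype symbol = Zero | One | Sep

fun bin :: "nat \<Rightarrow> symbol list" where
  "bin n = (if n < 2 then [] else bin (n div 2)) @ [if even n then Zero else One]"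

declare bin.simps [simp del]

definition enc_nums :: "nat list \<Rightarrow> symbol list" where
  "enc_nums ns = concat (map (\<lambda>n. bin n @ [Sep]) ns)"

definition with_length :: "nat list \<Rightarrow> nat list" where
  "with_length ns = length ns # ns"

definition edge_list :: "(nat, 'a) rcsp \<Rightarrow> (nat \<times> nat) list" where
  "edge_list \<Pi> = (let vs = sorted_list_of_set (verts \<Pi>) in
     filter (\<lambda>e. e \<in> edges \<Pi>) (List.product vs vs))"

text \<open>Each map \<open>\<pi>\<^bsub>e,u\<^esub>\<close> is written as the table of its values, in the order of the list of \<open>\<Sigma>\<close>.\<close>

definition rcsp_nums :: "(nat, nat) rcsp \<Rightarrow> nat list" where
  "rcsp_nums \<Pi> = (let xs = sorted_list_of_set (sigma \<Pi>); es = edge_list \<Pi> in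
     with_length (sorted_list_of_set (verts \<Pi>)) @
     length es # concat (map (\<lambda>(u, v). [u, v]) es) @
     with_length xs @
     with_length [1..<ups \<Pi> + 1] @
     concat (map (\<lambda>(u, v). map (proj \<Pi> (u, v) u) xs @ map (proj \<Pi> (u, v) v) xs) es))"

definition knapsack_nums :: "nat knapsack \<Rightarrow> nat list" where
  "knapsack_nums K = (let is = sorted_list_of_set (items K); js = [1..<dim K + 1] in
     dim K # length is #
     concat (map (\<lambda>i. i # profit K i # map (cost K i) js) is) @
     map (budget K) js)"

definition rcsp_size :: "(nat, nat) rcsp \<Rightarrow> nat" where
  "rcsp_size \<Pi> = length (enc_nums (rcsp_nums \<Pi>))"

definition knapsack_size :: "nat knapsack \<Rightarrow> nat" where
  "knapsack_size K = length (enc_nums (knapsack_nums K))"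


section \<open>Model of computation\<close>

text \<open>
  Running time is measured on a random access machine with logarithmic cost, programmed in a
  structured language. The memory consists of arrays of natural numbers, of which a program uses
  finitely many; a scalar variable is a cell with constant index. Every number that is read,
  written, used as an address or computed is charged with its binary length, so that running
  times are polynomially related to those of Turing machines.
\<close>

type_synonym memory = "nat \<Rightarrow> nat \<Rightarrow> nat"

datatype aexp =
    Const nat
  | Cell nat aexp
  | Plus aexp aexp
  | Minus aexp aexp

fun aval :: "aexp \<Rightarrow> memory \<Rightarrow> nat" where
  "aval (Const n) s = n"
| "aval (Cell k a) s = s k (aval a s)"
| "aval (Plus a b) s = aval a s + aval b s"
| "aval (Minus a b) s = aval a s - aval b s"  \<comment> \<open>truncated at 0\<close>

definition bitlen :: "nat \<Rightarrow> nat" where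
  "bitlen n = length (bin n)"

text \<open>
  The cost of an expression is the sum of the binary lengths of the values of all its
  subexpressions.
\<close>

fun acost :: "aexp \<Rightarrow> memory \<Rightarrow> nat" where
  "acost (Const n) s = bitlen n"
| "acost (Cell k a) s = acost a s + bitlen (aval (Cell k a) s)"
| "acost (Plus a b) s = acost a s + acost b s + bitlen (aval (Plus a b) s)"
| "acost (Minus a b) s = acost a s + acost b s + bitlen (aval (Minus a b) s)"

datatype com =
    Skip
  | Store nat aexp aexp
  | Seq com com
  | Cond aexp com com
  | While aexp com

text \<open>
  \<open>exec c s t s'\<close>: started in memory \<open>s\<close>, the program \<open>c\<close> halts after time \<open>t\<close> in memory \<open>s'\<close>.
  \<open>Store k a b\<close> writes the value of \<open>b\<close> to the cell of array \<open>k\<close> whose index is the value of \<open>a\<close>;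
  tests succeed if the value is nonzero.
\<close>

inductive exec :: "com \<Rightarrow> memory \<Rightarrow> nat \<Rightarrow> memory \<Rightarrow> bool" where
  Skip: "exec Skip s 1 s"
| Store: "exec (Store k a b) s (acost a s + acost b s) (s(k := (s k)(aval a s := aval b s)))"
| Seq: "exec c s t s' \<Longrightarrow> exec d s' t' s'' \<Longrightarrow> exec (Seq c d) s (t + t') s''"
| CondTrue: "aval a s \<noteq> 0 \<Longrightarrow> exec c s t s' \<Longrightarrow> exec (Cond a c d) s (acost a s + t) s'"
| CondFalse: "aval a s = 0 \<Longrightarrow> exec d s t s' \<Longrightarrow> exec (Cond a c d) s (acost a s + t) s'"
| WhileFalse: "aval a s = 0 \<Longrightarrow> exec (While a c) s (acost a s) s"
| WhileTrue: "aval a s \<noteq> 0 \<Longrightarrow> exec c s t s' \<Longrightarrow> exec (While a c) s' t' s'' \<Longrightarrow>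
    exec (While a c) s (acost a s + t + t') s''"

fun code :: "symbol \<Rightarrow> nat" where
  "code Zero = 1"
| "code One = 2"
| "code Sep = 3"

definition cells :: "symbol list \<Rightarrow> nat \<Rightarrow> nat" where
  "cells w i = (if i < length w then code (w ! i) else 0)"

text \<open>
  The input is provided in array 0, all other cells being 0; the output is expected in array 1.
\<close>

definition computes_within :: "com \<Rightarrow> symbol list \<Rightarrow> symbol list \<Rightarrow> nat \<Rightarrow> bool" where
  "computes_within c x y T \<longleftrightarrow>
     (\<exists>t s. exec c ((\<lambda>k i. 0)(0 := cells x)) t s \<and> s 1 = cells y \<and> t \<le> T)"

definition computes_reduction_within ::
  "com \<Rightarrow> (nat, nat) rcsp \<Rightarrow> nat \<Rightarrow> nat knapsack \<Rightarrow> nat \<Rightarrow> bool" where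
  "computes_reduction_within c \<Pi> F K T \<longleftrightarrow>
     computes_within c (enc_nums (F # rcsp_nums \<Pi>)) (enc_nums (knapsack_nums K)) T"

end

theory Submission
  imports Defs
begin

text \<open>
  Vertices and edges together are the \<open>T = |V| + |E|\<close> objects, split into groups of \<open>F\<close>. An item is an
  assignment of a symbol \<open>x\<close> to a vertex \<open>v\<close>; it is incident to the object \<open>v\<close> and to the edges at \<open>v\<close>,
  and its profit is the number of these incidences. It contributes to each incident object one digit
  of a number in a large base: 1 for \<open>v\<close>, \<open>\<pi>\<^bsub>e,u\<^esub>(x)\<close> at the first end of an edge \<open>e\<close>, and
  \<open>m - \<pi>\<^bsub>e,w\<^esub>(x)\<close> at the other end. A vertex has to receive the total 1 and an edge the total \<open>m\<close>.
  Each group has two dimensions, for these numbers and for their complements to a constant \<open>W\<close> per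
  incidence. Adding the two constraints bounds the profit earned in a group, and in a group that
  earns the maximal profit both constraints are tight, so all digits are as prescribed: its vertices
  have exactly one symbol and its edges are satisfied. A solution that misses \<open>q\<close> units of profit has
  at most \<open>q\<close> groups that are not tight. Removing their vertices and one endpoint of each of their edges discards
  at most \<open>q F\<close> vertices.

  The instance is a nest of bounded sums and loops over the input, hence is computed by a program
  with polynomially many iterations of each loop.
\<close>

section \<open>Binary length and binary digits\<close>

lemma bitlen_rec: "bitlen n = (if n < 2 then 1 else Suc (bitlen (n div 2)))"
  unfolding bitlen_def by (subst bin.simps) simp

lemma bitlen_pos: "0 < bitlen n"
  by (subst bitlen_rec) simp

text \<open>The condition \<open>0 < k\<close> reflects that 0 is written with one digit, so
  \<open>bitlen 0 = 1\<close>.\<close>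

lemma bitlen_le: "n < 2 ^ k \<Longrightarrow> 0 < k \<Longrightarrow> bitlen n \<le> k"
proof (induction k arbitrary: n)
  case 0
  then show ?case by simp
next
  case (Suc k)
  show ?case
  proof (cases "n < 2")
    case True
    then show ?thesis by (subst bitlen_rec) simp
  next
    case False
    then have "0 < k" using Suc.prems by (cases k) auto
    moreover have "n div 2 < 2 ^ k" using Suc.prems by simp
    ultimately show ?thesis using Suc.IH False by (subst bitlen_rec) simp
  qed
qed

lemma less_two_power_bitlen: "n < 2 ^ bitlen n"
proof (induction n rule: less_induct)
  case (less n)
  show ?case
  proof (cases "n < 2")
    case True
    then show ?thesis by (subst bitlen_rec) simp
  next
    case False
    with less[of "n div 2"] have "n div 2 < 2 ^ bitlen (n div 2)" by simp
    with False show ?thesis by (subst bitlen_rec) simp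
  qed
qed

lemma two_power_le_of_less_bitlen: "0 < i \<Longrightarrow> i < bitlen n \<Longrightarrow> 2 ^ i \<le> n"
  using bitlen_le[of n i] by (meson not_le)

text \<open>Digits are written most significant first, so position \<open>i\<close> has weight
  \<open>2 ^ (bitlen n - 1 - i)\<close>. The printing loop produces them in this order.\<close>

lemma nth_bin:
  "i < bitlen n \<Longrightarrow> bin n ! i = (if even (n div 2 ^ (bitlen n - 1 - i)) then Zero else One)"
proof (induction n arbitrary: i rule: less_induct)
  case (less n)
  show ?case
  proof (cases "n < 2")
    case True
    then show ?thesis using less.prems by (subst bin.simps) (simp add: bitlen_rec[of n])
  next
    case False
    have L: "bitlen n = Suc (bitlen (n div 2))" using False by (simp add: bitlen_rec[of n])
    have b: "bin n = bin (n div 2) @ [if even n then Zero else One]"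
      using False by (subst bin.simps) simp
    show ?thesis
    proof (cases "i < bitlen (n div 2)")
      case True
      then have "bitlen (n div 2) - i = Suc (bitlen (n div 2) - 1 - i)" by simp
      then have "n div 2 ^ (bitlen n - 1 - i) = n div 2 div 2 ^ (bitlen (n div 2) - 1 - i)"
        unfolding L by (simp add: div_mult2_eq)
      then show ?thesis using less.IH[of "n div 2" i] False True b
        by (simp add: nth_append bitlen_def)
    next
      case f: False
      then have "i = bitlen (n div 2)" using less.prems L by simp
      then show ?thesis using b L by (simp add: nth_append bitlen_def)
    qed
  qed
qed

section \<open>Counting steps\<close>

text \<open>
  Addition and truncated subtraction add at most a constant to the binary length of the numbers in
  memory, so after polynomially many steps all numbers have polynomial length. It is therefore
  enough to count the steps.
\<close>

inductive steps :: "com \<Rightarrow> memory \<Rightarrow> nat \<Rightarrow> memory \<Rightarrow> bool" where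
  Skip: "steps Skip s 1 s"
| Store: "steps (Store k a b) s 1 (s(k := (s k)(aval a s := aval b s)))"
| Seq: "steps c s n s' \<Longrightarrow> steps d s' n' s'' \<Longrightarrow> steps (Seq c d) s (n + n') s''"
| CondTrue: "aval a s \<noteq> 0 \<Longrightarrow> steps c s n s' \<Longrightarrow> steps (Cond a c d) s (1 + n) s'"
| CondFalse: "aval a s = 0 \<Longrightarrow> steps d s n s' \<Longrightarrow> steps (Cond a c d) s (1 + n) s'"
| WhileFalse: "aval a s = 0 \<Longrightarrow> steps (While a c) s 1 s"
| WhileTrue: "aval a s \<noteq> 0 \<Longrightarrow> steps c s n s' \<Longrightarrow> steps (While a c) s' n' s'' \<Longrightarrow>
    steps (While a c) s (1 + n + n') s''"

text \<open>A constant counts with its value rather than its length, so that evaluation raises a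
  bound \<open>2 ^ A\<close> on the memory by a factor of at most
  \<open>2 ^ asize a\<close>.\<close>

fun asize :: "aexp \<Rightarrow> nat" where
  "asize (Const n) = n + 1"
| "asize (Cell k a) = asize a + 1"
| "asize (Plus a b) = asize a + asize b + 1"
| "asize (Minus a b) = asize a + asize b + 1"

fun csize :: "com \<Rightarrow> nat" where
  "csize Skip = 1"
| "csize (Store k a b) = asize a + asize b"
| "csize (Seq c d) = csize c + csize d"
| "csize (Cond a c d) = asize a + csize c + csize d"
| "csize (While a c) = asize a + csize c"

text \<open>The \<open>+ 1\<close> in the size of a sum pays for the doubling by an addition. A
  \<open>Cell\<close> returns a value of at most \<open>2 ^ A\<close> whatever its address is, so
  nested addressing does not accumulate.\<close>

lemma aval_le:
  assumes "\<And>k i. s k i \<le> 2 ^ A"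
  shows "aval a s \<le> 2 ^ (A + asize a)"
proof (induction a)
  case (Const n)
  have "n \<le> 2 ^ n" by simp
  also have "\<dots> \<le> 2 ^ (A + (n + 1))" by (rule power_increasing) auto
  finally show ?case by simp
next
  case (Cell k a)
  have "s k (aval a s) \<le> 2 ^ A" by (rule assms)
  also have "\<dots> \<le> 2 ^ (A + (asize a + 1))" by (rule power_increasing) auto
  finally show ?case by simp
next
  case (Plus a b)
  have "(2::nat) ^ (A + asize a) \<le> 2 ^ (A + asize a + asize b)"
    "(2::nat) ^ (A + asize b) \<le> 2 ^ (A + asize a + asize b)"
    by (auto intro!: power_increasing)
  with Plus have "aval a s + aval b s \<le> 2 * 2 ^ (A + asize a + asize b)" by linarith
  then show ?case by (simp add: add.assoc)
next
  case (Minus a b)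
  have "aval a s - aval b s \<le> 2 ^ (A + asize a)" using Minus by simp
  also have "\<dots> \<le> 2 ^ (A + asize (Minus a b))" by (rule power_increasing) auto
  finally show ?case by simp
qed

text \<open>There are at most \<open>asize a\<close> subexpressions, and each is charged at most
  \<open>A + asize a + 1\<close> by \<open>aval_le\<close>.\<close>

lemma acost_le:
  assumes s: "\<And>k i. s k i \<le> 2 ^ A"
  shows "acost a s \<le> (A + asize a + 1) * asize a"
proof -
  have b: "bitlen (aval a s) \<le> A + asize a + 1" for a
    using aval_le[of s A a, OF s] by (intro bitlen_le) (auto intro: le_less_trans)
  \<comment> \<open>Superadditivity of \<open>(A + x + 1) * x\<close>, with room for the charge of
    the new root. The unary \<open>Cell\<close> uses it with an empty second operand.\<close>
  have binop: "p + q + r \<le> (A + (x + y + 1) + 1) * (x + y + 1)"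
    if "p \<le> (A + x + 1) * x" "q \<le> (A + y + 1) * y" "r \<le> A + (x + y + 1) + 1"
    for p q r x y :: nat
  proof -
    have "(A + x + 1) * x \<le> (A + (x + y + 1) + 1) * x" "(A + y + 1) * y \<le> (A + (x + y + 1) + 1) * y"
      by (intro mult_right_mono; simp)+
    with that have "p + q + r \<le> (A + (x + y + 1) + 1) * x + (A + (x + y + 1) + 1) * y
      + (A + (x + y + 1) + 1)" by linarith
    then show ?thesis by (simp add: algebra_simps)
  qed
  show ?thesis
  proof (induction a)
    case (Const n)
    have "bitlen n \<le> A + (n + 1) + 1" using b[of "Const n"] by simp
    then show ?case by simp
  next
    case (Cell k a)
    have "bitlen (s k (aval a s)) \<le> A + (asize a + 1) + 1" using b[of "Cell k a"] by simp
    then show ?case using binop[of _ "asize a" 0 0] Cell by simp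
  next
    case (Plus a b')
    then show ?case using binop[OF Plus] b[of "Plus a b'"] by simp
  next
    case (Minus a b')
    then show ?case using binop[OF Minus] b[of "Minus a b'"] by simp
  qed
qed

text \<open>Each step raises the exponent \<open>A\<close> by at most \<open>K\<close>, hence it
  stays below \<open>A + K * n\<close> throughout, and this bounds the charge of every single step.
  \<open>A\<close> is generalised because the second part of a run starts from the raised
  exponent.\<close>

lemma steps_imp_exec:
  assumes "steps c s n s'" "csize c \<le> K" "\<And>k i. s k i \<le> 2 ^ A"
  shows "(\<forall>k i. s' k i \<le> 2 ^ (A + K * n)) \<and>
    (\<exists>t. exec c s t s' \<and> t \<le> n * ((A + K * n + K + 1) * K))"
  using assms
proof (induction arbitrary: A rule: steps.induct)
  case (Skip s)
  have "s k i \<le> 2 ^ (A + K * 1)" for k i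
    using Skip(2)[of k i] by (rule order_trans) (simp add: power_increasing)
  moreover have "1 \<le> (A + K + K + 1) * K" using Skip by simp
  ultimately show ?case using exec.Skip[of s] by auto
next
  case (Store k a b s)
  have s: "\<And>k i. s k i \<le> 2 ^ A" by (rule Store)
  have K: "asize a + asize b \<le> K" using Store by simp
  have "aval b s \<le> 2 ^ (A + asize b)" by (rule aval_le) (rule s)
  also have "\<dots> \<le> 2 ^ (A + K * 1)" by (rule power_increasing) (use K in auto)
  finally have b: "aval b s \<le> 2 ^ (A + K * 1)" .
  have s': "s k i \<le> 2 ^ (A + K * 1)" for k i
    using s[of k i] by (rule order_trans) (simp add: power_increasing)
  have ca: "acost a s \<le> (A + asize a + 1) * asize a" "acost b s \<le> (A + asize b + 1) * asize b"
    by (rule acost_le, rule s)+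
  have "(A + asize a + 1) * asize a \<le> (A + K * 1 + K + 1) * asize a"
    "(A + asize b + 1) * asize b \<le> (A + K * 1 + K + 1) * asize b"
    using K by (intro mult_right_mono; simp)+
  with ca have "acost a s + acost b s \<le> (A + K * 1 + K + 1) * (asize a + asize b)"
    unfolding distrib_left by linarith
  also have "\<dots> \<le> (A + K * 1 + K + 1) * K" using K by (intro mult_left_mono) auto
  finally have "\<exists>t. exec (Store k a b) s t (s(k := (s k)(aval a s := aval b s))) \<and>
      t \<le> 1 * ((A + K * 1 + K + 1) * K)"
    using exec.Store[of k a b s] by (metis mult_1)
  moreover have "\<forall>l i. (s(k := (s k)(aval a s := aval b s))) l i \<le> 2 ^ (A + K * 1)"
    using b s' by simp
  ultimately show ?case by blast
next
  case (Seq c s n s' d n' s'')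
  from Seq.IH(1)[of A] Seq.prems obtain t where
    1: "\<And>k i. s' k i \<le> 2 ^ (A + K * n)" "exec c s t s'" "t \<le> n * ((A + K * n + K + 1) * K)"
    by auto
  from Seq.IH(2)[OF _ 1(1)] Seq.prems obtain t' where
    2: "\<And>k i. s'' k i \<le> 2 ^ (A + K * n + K * n')" "exec d s' t' s''"
       "t' \<le> n' * ((A + K * n + K * n' + K + 1) * K)"
    by auto
  have "n * ((A + K * n + K + 1) * K) \<le> n * ((A + K * (n + n') + K + 1) * K)"
    by (intro mult_left_mono mult_right_mono) (auto simp: algebra_simps)
  then have "t + t' \<le> (n + n') * ((A + K * (n + n') + K + 1) * K)"
    using 1(3) 2(3) by (simp add: algebra_simps)
  with exec.Seq[OF 1(2) 2(2)] 2(1) show ?case by (auto simp: algebra_simps)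
next
  case (CondTrue a s c n s' d)
  have s: "\<And>k i. s k i \<le> 2 ^ A" by (rule CondTrue)
  from CondTrue.IH[of A] CondTrue.prems obtain t where
    1: "\<And>k i. s' k i \<le> 2 ^ (A + K * n)" "exec c s t s'" "t \<le> n * ((A + K * n + K + 1) * K)"
    by auto
  have "acost a s \<le> (A + asize a + 1) * asize a" by (rule acost_le) (rule s)
  also have "\<dots> \<le> (A + K * (1 + n) + K + 1) * K" using CondTrue by (intro mult_mono) auto
  finally have "acost a s \<le> (A + K * (1 + n) + K + 1) * K" .
  moreover have "n * ((A + K * n + K + 1) * K) \<le> n * ((A + K * (1 + n) + K + 1) * K)"
    by (intro mult_left_mono mult_right_mono) auto
  ultimately have "acost a s + t \<le> (1 + n) * ((A + K * (1 + n) + K + 1) * K)"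
    using 1(3) unfolding distrib_right[of 1 n] by linarith
  moreover have "s' k i \<le> 2 ^ (A + K * (1 + n))" for k i
    using 1(1)[of k i] by (rule order_trans) (auto intro!: power_increasing)
  ultimately show ?case using exec.CondTrue[OF CondTrue.hyps(1) 1(2)] by blast
next
  case (CondFalse a s d n s' c)
  have s: "\<And>k i. s k i \<le> 2 ^ A" by (rule CondFalse)
  from CondFalse.IH[of A] CondFalse.prems obtain t where
    1: "\<And>k i. s' k i \<le> 2 ^ (A + K * n)" "exec d s t s'" "t \<le> n * ((A + K * n + K + 1) * K)"
    by auto
  have "acost a s \<le> (A + asize a + 1) * asize a" by (rule acost_le) (rule s)
  also have "\<dots> \<le> (A + K * (1 + n) + K + 1) * K" using CondFalse by (intro mult_mono) auto
  finally have "acost a s \<le> (A + K * (1 + n) + K + 1) * K" .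
  moreover have "n * ((A + K * n + K + 1) * K) \<le> n * ((A + K * (1 + n) + K + 1) * K)"
    by (intro mult_left_mono mult_right_mono) auto
  ultimately have "acost a s + t \<le> (1 + n) * ((A + K * (1 + n) + K + 1) * K)"
    using 1(3) unfolding distrib_right[of 1 n] by linarith
  moreover have "s' k i \<le> 2 ^ (A + K * (1 + n))" for k i
    using 1(1)[of k i] by (rule order_trans) (auto intro!: power_increasing)
  ultimately show ?case using exec.CondFalse[OF CondFalse.hyps(1) 1(2)] by blast
next
  case (WhileFalse a s c)
  have s: "\<And>k i. s k i \<le> 2 ^ A" by (rule WhileFalse)
  have "acost a s \<le> (A + asize a + 1) * asize a" by (rule acost_le) (rule s)
  also have "\<dots> \<le> (A + K * 1 + K + 1) * K" using WhileFalse by (intro mult_mono) auto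
  finally have "acost a s \<le> (A + K * 1 + K + 1) * K" .
  moreover have "s k i \<le> 2 ^ (A + K * 1)" for k i
    using s[of k i] by (rule order_trans) (auto intro!: power_increasing)
  ultimately show ?case using exec.WhileFalse[OF WhileFalse.hyps(1)] by auto
next
  case (WhileTrue a s c n s' n' s'')
  have s: "\<And>k i. s k i \<le> 2 ^ A" by (rule WhileTrue)
  have K: "csize c \<le> K" "asize a \<le> K" using WhileTrue.prems by auto
  from WhileTrue.IH(1)[of A] K s obtain t where
    1: "\<And>k i. s' k i \<le> 2 ^ (A + K * n)" "exec c s t s'" "t \<le> n * ((A + K * n + K + 1) * K)"
    by auto
  from WhileTrue.IH(2)[OF _ 1(1)] WhileTrue.prems obtain t' where
    2: "\<And>k i. s'' k i \<le> 2 ^ (A + K * n + K * n')" "exec (While a c) s' t' s''"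
       "t' \<le> n' * ((A + K * n + K * n' + K + 1) * K)"
    by auto
  define Z where "Z = (A + K * (1 + n + n') + K + 1) * K"
  have "acost a s \<le> (A + asize a + 1) * asize a" by (rule acost_le) (rule s)
  also have "\<dots> \<le> Z" unfolding Z_def using K by (intro mult_mono) auto
  finally have a: "acost a s \<le> Z" .
  have "n * ((A + K * n + K + 1) * K) \<le> n * Z" "n' * ((A + K * n + K * n' + K + 1) * K) \<le> n' * Z"
    unfolding Z_def by (intro mult_left_mono mult_right_mono; simp add: algebra_simps)+
  then have "acost a s + t + t' \<le> (1 + n + n') * Z"
    using a 1(3) 2(3) by (simp add: algebra_simps)
  moreover have "s'' k i \<le> 2 ^ (A + K * (1 + n + n'))" for k i
    using 2(1)[of k i] by (rule order_trans) (auto intro!: power_increasing simp: algebra_simps)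
  ultimately show ?case using exec.WhileTrue[OF WhileTrue.hyps(1) 1(2) 2(2)] unfolding Z_def by blast
qed

text \<open>A bound on the steps if every execution of a loop makes at most \<open>M\<close> rounds.
  For a fixed program it is a polynomial in \<open>M\<close>.\<close>

fun step_bound :: "nat \<Rightarrow> com \<Rightarrow> nat" where
  "step_bound M Skip = 1"
| "step_bound M (Store k a b) = 1"
| "step_bound M (Seq c d) = step_bound M c + step_bound M d"
| "step_bound M (Cond a c d) = 1 + step_bound M c + step_bound M d"
| "step_bound M (While a c) = 1 + M * (1 + step_bound M c)"

lemma asize_pos: "0 < asize a"
  by (cases a) auto

lemma csize_pos: "0 < csize c"
  using asize_pos by (induction c) auto

lemma two_le_power: "0 < k \<Longrightarrow> 2 \<le> (M + 2) ^ k" for M k :: nat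
  by (rule order_trans[OF le_add2 self_le_power]) auto

text \<open>The base \<open>M + 2\<close> makes all powers involved at least 2, and the sum of two
  numbers that are at least 2 is at most their product. So the bounds of the parts combine by adding
  exponents.\<close>

lemma step_bound_le: "step_bound M c \<le> (M + 2) ^ csize c"
proof (induction c)
  case (Seq c d)
  obtain x y where "(M + 2) ^ csize c = 2 + x" "(M + 2) ^ csize d = 2 + y"
    using two_le_power csize_pos le_Suc_ex by metis
  then have "(M + 2) ^ csize c + (M + 2) ^ csize d \<le> (M + 2) ^ csize c * (M + 2) ^ csize d"
    by simp
  with Seq show ?case by (simp add: power_add)
next
  case (Cond a c d)
  obtain x y z where "(M + 2) ^ csize c = 2 + x" "(M + 2) ^ csize d = 2 + y"
    "(M + 2) ^ asize a = 2 + z"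
    using two_le_power csize_pos asize_pos le_Suc_ex by metis
  moreover have "1 + (2 + x) + (2 + y) \<le> (2 + z) * ((2 + x) * (2 + y))" for x y z :: nat
    by (simp add: algebra_simps)
  ultimately show ?case using Cond by (simp add: power_add mult.assoc)
next
  case (While a c)
  define X where "X = (M + 2) ^ csize c"
  have X: "M + 2 \<le> X" unfolding X_def using csize_pos by (intro self_le_power) auto
  have "1 + M * (1 + step_bound M c) \<le> 1 + M * (1 + X)" using While by (simp add: X_def)
  also have "\<dots> \<le> (M + 2) * X" using X by (simp add: algebra_simps)
  also have "\<dots> \<le> (M + 2) ^ asize a * X"
    using asize_pos[of a] by (intro mult_right_mono self_le_power) auto
  finally show ?case by (simp add: power_add X_def)
qed auto

text \<open>Total correctness in the style of weakest preconditions, with the step bound built in: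
  termination and running time come along with the functional result.\<close>

definition reaches :: "nat \<Rightarrow> com \<Rightarrow> memory \<Rightarrow> (memory \<Rightarrow> bool) \<Rightarrow> bool" where
  "reaches M c s Q \<longleftrightarrow> (\<exists>n s'. steps c s n s' \<and> n \<le> step_bound M c \<and> Q s')"

lemma reaches_Store:
  "Q (s(k := (s k)(aval a s := aval b s))) \<Longrightarrow> reaches M (Store k a b) s Q"
  unfolding reaches_def using steps.Store by fastforce

lemma reaches_Seq: "reaches M c s (\<lambda>s'. reaches M d s' Q) \<Longrightarrow> reaches M (Seq c d) s Q"
  unfolding reaches_def by (auto) (meson add_mono steps.Seq)

lemma reaches_Cond:
  assumes "aval a s \<noteq> 0 \<Longrightarrow> reaches M c s Q" "aval a s = 0 \<Longrightarrow> reaches M d s Q"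
  shows "reaches M (Cond a c d) s Q"
proof (cases "aval a s = 0")
  case True
  then obtain n s' where "steps d s n s'" "n \<le> step_bound M d" "Q s'"
    using assms(2) by (auto simp: reaches_def)
  then show ?thesis using steps.CondFalse[OF True, of d n s' c]
    by (force simp: reaches_def)
next
  case False
  then obtain n s' where "steps c s n s'" "n \<le> step_bound M c" "Q s'"
    using assms(1) by (auto simp: reaches_def)
  then show ?thesis using steps.CondTrue[OF False, of c n s' d]
    by (force simp: reaches_def)
qed

lemma reaches_mono: "reaches M c s Q \<Longrightarrow> (\<And>s'. Q s' \<Longrightarrow> Q' s') \<Longrightarrow> reaches M c s Q'"
  unfolding reaches_def by blast

text \<open>The invariant is indexed by the number of completed rounds and the loop makes exactly
  \<open>m\<close> of them, so it serves as the termination measure too.\<close>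

lemma reaches_While:
  assumes "m \<le> M" "I 0 s"
    and body: "\<And>i s. i < m \<Longrightarrow> I i s \<Longrightarrow> aval a s \<noteq> 0 \<and> reaches M c s (I (Suc i))"
    and exit: "\<And>s. I m s \<Longrightarrow> aval a s = 0"
    and Q: "\<And>s. I m s \<Longrightarrow> Q s"
  shows "reaches M (While a c) s Q"
proof -
  \<comment> \<open>Induction on the number \<open>j\<close> of remaining rounds, with the exact
    count in the bound; \<open>m \<le> M\<close> enters only afterwards.\<close>
  have "\<exists>n s'. steps (While a c) s n s' \<and> n \<le> 1 + j * (1 + step_bound M c) \<and> I m s'"
    if "I i s" "i + j = m" for i j s
    using that
  proof (induction j arbitrary: i s)
    case 0
    then show ?case using steps.WhileFalse[OF exit] by fastforce
  next
    case (Suc j)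
    from body[of i s] Suc.prems obtain n s' where
      1: "aval a s \<noteq> 0" "steps c s n s'" "n \<le> step_bound M c" "I (Suc i) s'"
      by (auto simp: reaches_def)
    from Suc.IH[OF 1(4)] Suc.prems obtain n' s'' where
      2: "steps (While a c) s' n' s''" "n' \<le> 1 + j * (1 + step_bound M c)" "I m s''"
      by auto
    have "1 + n + n' \<le> 1 + Suc j * (1 + step_bound M c)" using 1 2 by simp
    with steps.WhileTrue[OF 1(1,2) 2(1)] 2(3) show ?case by blast
  qed
  from this[of 0 s m] assms(2) obtain n s' where
    1: "steps (While a c) s n s'" "n \<le> 1 + m * (1 + step_bound M c)" "I m s'" by auto
  have "m * (1 + step_bound M c) \<le> M * (1 + step_bound M c)"
    using assms(1) by (rule mult_right_mono) simp
  with 1 have "n \<le> step_bound M (While a c)" by simp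
  with 1 Q show ?thesis unfolding reaches_def by blast
qed

section \<open>A language of bounded loops\<close>

text \<open>An intermediate language whose only iteration is bounded. Its meaning is a plain
  function, so the instance can be written as formulas; comparisons will come from truncated
  subtraction.\<close>

datatype expr =
    Num nat
  | Var nat
  | Inp expr
  | Add expr expr
  | Sub expr expr
  | Mul expr expr
  | Pow2 expr
  | Sum nat expr expr

fun eval :: "(nat \<Rightarrow> nat) \<Rightarrow> expr \<Rightarrow> (nat \<Rightarrow> nat) \<Rightarrow> nat" where
  "eval inp (Num n) env = n"
| "eval inp (Var v) env = env v"
| "eval inp (Inp e) env = inp (eval inp e env)"
| "eval inp (Add a b) env = eval inp a env + eval inp b env"
| "eval inp (Sub a b) env = eval inp a env - eval inp b env"
| "eval inp (Mul a b) env = eval inp a env * eval inp b env"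
| "eval inp (Pow2 a) env = 2 ^ eval inp a env"
| "eval inp (Sum v a b) env = (\<Sum>i<eval inp a env. eval inp b (env(v := i)))"

text \<open>Multiplication is compiled to iterated addition, controlled by the first factor.\<close>

fun loops_le :: "nat \<Rightarrow> (nat \<Rightarrow> nat) \<Rightarrow> expr \<Rightarrow> (nat \<Rightarrow> nat) \<Rightarrow> bool" where
  "loops_le M inp (Num n) env = True"
| "loops_le M inp (Var v) env = True"
| "loops_le M inp (Inp e) env = loops_le M inp e env"
| "loops_le M inp (Add a b) env = (loops_le M inp a env \<and> loops_le M inp b env)"
| "loops_le M inp (Sub a b) env = (loops_le M inp a env \<and> loops_le M inp b env)"
| "loops_le M inp (Mul a b) env =
     (loops_le M inp a env \<and> loops_le M inp b env \<and> eval inp a env \<le> M)"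
| "loops_le M inp (Pow2 a) env = (loops_le M inp a env \<and> eval inp a env \<le> M)"
| "loops_le M inp (Sum v a b) env =
     (loops_le M inp a env \<and> eval inp a env \<le> M \<and>
      (\<forall>i<eval inp a env. loops_le M inp b (env(v := i))))"

text \<open>
  Array 2 holds the input numbers, array 4 the variables, and array 5 is a stack of which the
  compiled expression uses the cells from \<open>d\<close> on; the value is returned in cell \<open>d\<close>.
\<close>

abbreviation stack :: "nat \<Rightarrow> aexp" where "stack d \<equiv> Cell 5 (Const d)"
abbreviation set_stack :: "nat \<Rightarrow> aexp \<Rightarrow> com" where "set_stack d \<equiv> Store 5 (Const d)"

fun compile :: "expr \<Rightarrow> nat \<Rightarrow> com" where
  "compile (Num n) d = set_stack d (Const n)"
| "compile (Var v) d = set_stack d (Cell 4 (Const v))"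
| "compile (Inp e) d = Seq (compile e d) (set_stack d (Cell 2 (stack d)))"
| "compile (Add a b) d = Seq (compile a d) (Seq (compile b (d + 1))
     (set_stack d (Plus (stack d) (stack (d + 1)))))"
| "compile (Sub a b) d = Seq (compile a d) (Seq (compile b (d + 1))
     (set_stack d (Minus (stack d) (stack (d + 1)))))"
| "compile (Mul a b) d = Seq (compile a d) (Seq (compile b (d + 1))
     (Seq (set_stack (d + 2) (Const 0))
     (Seq (While (stack d)
        (Seq (set_stack (d + 2) (Plus (stack (d + 2)) (stack (d + 1))))
             (set_stack d (Minus (stack d) (Const 1)))))
     (set_stack d (stack (d + 2))))))"
| "compile (Pow2 a) d = Seq (compile a d)
     (Seq (set_stack (d + 1) (Const 1))
     (Seq (While (stack d)
        (Seq (set_stack (d + 1) (Plus (stack (d + 1)) (stack (d + 1))))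
             (set_stack d (Minus (stack d) (Const 1)))))
     (set_stack d (stack (d + 1)))))"
| "compile (Sum v a b) d = Seq (compile a d)
     (Seq (set_stack (d + 1) (Cell 4 (Const v)))
     (Seq (set_stack (d + 2) (Const 0))
     (Seq (Store 4 (Const v) (Const 0))
     (Seq (While (Minus (stack d) (Cell 4 (Const v)))
        (Seq (compile b (d + 3))
        (Seq (set_stack (d + 2) (Plus (stack (d + 2)) (stack (d + 3))))
             (Store 4 (Const v) (Plus (Cell 4 (Const v)) (Const 1))))))
     (Seq (Store 4 (Const v) (stack (d + 1)))
          (set_stack d (stack (d + 2))))))))"

text \<open>This includes the variables in array 4: \<open>Sum\<close> uses one as its loop counter,
  but saves the old value on the stack and restores it.\<close>

definition keeps :: "nat \<Rightarrow> memory \<Rightarrow> memory \<Rightarrow> bool" where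
  "keeps d s s' \<longleftrightarrow> (\<forall>k. k \<noteq> 5 \<longrightarrow> s' k = s k) \<and> (\<forall>i<d. s' 5 i = s 5 i)"

lemma reaches_compile:
  "loops_le M (s 2) e (s 4) \<Longrightarrow>
   reaches M (compile e d) s (\<lambda>s'. s' 5 d = eval (s 2) e (s 4) \<and> keeps d s s')"
proof (induction e arbitrary: d s)
  case (Num n)
  then show ?case by (auto intro!: reaches_Store simp: keeps_def)
next
  case (Var v)
  then show ?case by (auto intro!: reaches_Store simp: keeps_def)
next
  case (Inp e)
  from Inp.prems have "loops_le M (s 2) e (s 4)" by simp
  from Inp.IH[OF this, of d] show ?case
    by (auto intro!: reaches_Store reaches_Seq elim!: reaches_mono simp: keeps_def)
next
  case (Add a b)
  \<comment> \<open>The second operand is evaluated one cell higher on the stack, so the first value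
    in cell \<open>d\<close> survives.\<close>
  have binop: "reaches M (compile b (d + 1)) s1
    (\<lambda>s2. s2 5 (d + 1) = eval (s 2) b (s 4) \<and> s2 5 d = s1 5 d \<and> keeps d s s2)"
    if "keeps d s s1" for s1
    by (rule reaches_mono[OF Add.IH(2)])
      (use that Add.prems in \<open>auto simp: keeps_def\<close>)
  show ?case unfolding compile.simps
    apply (rule reaches_Seq, rule reaches_mono[OF Add.IH(1)])
    subgoal using Add.prems by simp
    apply (rule reaches_Seq, rule reaches_mono[OF binop])
     apply simp
    apply (rule reaches_Store)
    apply (auto simp: keeps_def)
    done
next
  case (Sub a b)
  have binop: "reaches M (compile b (d + 1)) s1
    (\<lambda>s2. s2 5 (d + 1) = eval (s 2) b (s 4) \<and> s2 5 d = s1 5 d \<and> keeps d s s2)"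
    if "keeps d s s1" for s1
    by (rule reaches_mono[OF Sub.IH(2)])
      (use that Sub.prems in \<open>auto simp: keeps_def\<close>)
  show ?case unfolding compile.simps
    apply (rule reaches_Seq, rule reaches_mono[OF Sub.IH(1)])
    subgoal using Sub.prems by simp
    apply (rule reaches_Seq, rule reaches_mono[OF binop])
     apply simp
    apply (rule reaches_Store)
    apply (auto simp: keeps_def)
    done
next
  case (Mul a b)
  let ?A = "eval (s 2) a (s 4)" and ?B = "eval (s 2) b (s 4)"
  have binop: "reaches M (compile b (d + 1)) s1
    (\<lambda>s2. s2 5 (d + 1) = ?B \<and> s2 5 d = s1 5 d \<and> keeps d s s2)"
    if "keeps d s s1" for s1
    by (rule reaches_mono[OF Mul.IH(2)])
      (use that Mul.prems in \<open>auto simp: keeps_def\<close>)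
  show ?case unfolding compile.simps
    apply (rule reaches_Seq, rule reaches_mono[OF Mul.IH(1)])
    subgoal using Mul.prems by simp
    apply (rule reaches_Seq, rule reaches_mono[OF binop])
     apply simp
    apply (rule reaches_Seq, rule reaches_Store)
    apply (rule reaches_Seq)
    \<comment> \<open>The first factor counts down in cell \<open>d\<close> while copies of the
      second accumulate in cell \<open>d + 2\<close>.\<close>
    apply (rule reaches_While[where m = ?A and I = "\<lambda>i s'. s' 5 d = ?A - i \<and> s' 5 (d + 1) = ?B \<and>
      s' 5 (d + 2) = i * ?B \<and> keeps d s s'"])
    subgoal using Mul.prems by simp
    subgoal by (auto simp: keeps_def)
    subgoal by (auto intro!: reaches_Seq reaches_Store simp: keeps_def)
    subgoal by auto
    subgoal by (auto intro!: reaches_Store simp: keeps_def)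
    done
next
  case (Pow2 a)
  let ?A = "eval (s 2) a (s 4)"
  show ?case unfolding compile.simps
    apply (rule reaches_Seq, rule reaches_mono[OF Pow2.IH])
    subgoal using Pow2.prems by simp
    apply (rule reaches_Seq, rule reaches_Store)
    apply (rule reaches_Seq)
    apply (rule reaches_While[where m = ?A and I = "\<lambda>i s'. s' 5 d = ?A - i \<and>
      s' 5 (d + 1) = 2 ^ i \<and> keeps d s s'"])
    subgoal using Pow2.prems by simp
    subgoal by (auto simp: keeps_def)
    subgoal by (auto intro!: reaches_Seq reaches_Store simp: keeps_def)
    subgoal by auto
    subgoal by (auto intro!: reaches_Store simp: keeps_def)
    done
next
  case (Sum v a b)
  let ?A = "eval (s 2) a (s 4)" and ?B = "\<lambda>i. eval (s 2) b ((s 4)(v := i))"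
  \<comment> \<open>\<open>keeps\<close> is violated during the loop, since \<open>v\<close> holds
    the counter; the invariant therefore records the saved value in cell
    \<open>d + 1\<close>.\<close>
  define I where "I = (\<lambda>i (s'::memory). (\<forall>k. k \<noteq> 4 \<and> k \<noteq> 5 \<longrightarrow> s' k = s k) \<and> s' 4 = (s 4)(v := i) \<and>
      s' 5 d = ?A \<and> s' 5 (d + 1) = s 4 v \<and> s' 5 (d + 2) = (\<Sum>j<i. ?B j) \<and> (\<forall>i<d. s' 5 i = s 5 i))"
  have body: "reaches M (compile b (d + 3)) s1 (\<lambda>s2. s2 5 (d + 3) = ?B i \<and> I i s2)"
    if "I i s1" "i < ?A" for i s1
  proof -
    have s1: "s1 2 = s 2" "s1 4 = (s 4)(v := i)" using that by (auto simp: I_def)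
    have "loops_le M (s1 2) b (s1 4)" unfolding s1 using Sum.prems that(2) by simp
    from Sum.IH(2)[OF this, unfolded s1] show ?thesis
      by (rule reaches_mono) (use that(1) in \<open>simp add: keeps_def I_def del: fun_upd_apply\<close>)
  qed
  show ?case unfolding compile.simps
    apply (rule reaches_Seq, rule reaches_mono[OF Sum.IH(1)])
    subgoal using Sum.prems by simp
    apply (rule reaches_Seq, rule reaches_Store)
    apply (rule reaches_Seq, rule reaches_Store)
    apply (rule reaches_Seq, rule reaches_Store)
    apply (rule reaches_Seq)
    apply (rule reaches_While[where m = ?A and I = I])
    subgoal using Sum.prems by simp
    subgoal by (auto simp: keeps_def I_def)
    subgoal for s1 i s2
      apply (rule conjI)
      subgoal by (simp add: I_def)
      apply (rule reaches_Seq, rule reaches_mono[OF body], assumption, assumption)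
      apply (rule reaches_Seq, rule reaches_Store, rule reaches_Store)
      apply (auto simp: I_def)
      done
    subgoal by (auto simp: I_def)
    subgoal by (auto intro!: reaches_Seq reaches_Store simp: keeps_def I_def)
    done
qed

section \<open>Input and output\<close>

lemma cells_snoc: "(cells w)(length w := code c) = cells (w @ [c])"
  by (auto simp: cells_def nth_append)

definition put :: "symbol \<Rightarrow> com" where
  "put c = Seq (Store 1 (Cell 3 (Const 0)) (Const (code c)))
     (Store 3 (Const 0) (Plus (Cell 3 (Const 0)) (Const 1)))"

definition has_output :: "symbol list \<Rightarrow> memory \<Rightarrow> bool" where
  "has_output w s \<longleftrightarrow> s 1 = cells w \<and> s 3 0 = length w"

lemma reaches_put:
  assumes "has_output w s"
    and "\<And>s'. has_output (w @ [c]) s' \<Longrightarrow> (\<And>k. k \<noteq> 1 \<Longrightarrow> k \<noteq> 3 \<Longrightarrow> s' k = s k) \<Longrightarrow> Q s'"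
  shows "reaches M (put c) s Q"
  unfolding put_def
  by (rule reaches_Seq, rule reaches_Store, rule reaches_Store, rule assms(2))
    (use assms(1) cells_snoc[of w c] in \<open>auto simp: has_output_def\<close>)

text \<open>
  The binary digits are found greedily with the powers of 2, which are tabulated in array 6.
\<close>

definition print :: "nat \<Rightarrow> com" where
  "print d =
     (let x = stack d; j = stack (d + 1); P = Cell 6 j; set_j = set_stack (d + 1) in
      Seq (Store 6 (Const 0) (Const 1))
     (Seq (set_j (Const 0))
     (Seq (While (Minus (Plus x (Const 1)) (Plus P P))
        (Seq (Store 6 (Plus j (Const 1)) (Plus P P))
             (set_j (Plus j (Const 1)))))
     (Seq (set_j (Plus j (Const 1)))
     (Seq (While j
        (Seq (set_j (Minus j (Const 1)))
             (Cond (Minus (Plus x (Const 1)) P)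
                (Seq (put One) (set_stack d (Minus x P)))
                (put Zero))))
     (put Sep))))))"

lemma mod_two_power_Suc:
  fixes x :: nat
  shows "x mod 2 ^ Suc j = (if even (x div 2 ^ j) then 0 else 2 ^ j) + x mod 2 ^ j"
proof -
  have "x mod (2 ^ j * 2) = 2 ^ j * (x div 2 ^ j mod 2) + x mod 2 ^ j" by (rule mod_mult2_eq)
  then show ?thesis by (auto simp: mult.commute even_iff_mod_2_eq_zero odd_iff_mod_2_eq_one)
qed

lemma reaches_print:
  assumes out: "has_output w s" and M: "bitlen (s 5 d) \<le> M"
  shows "reaches M (print d) s (\<lambda>s'. has_output (w @ bin (s 5 d) @ [Sep]) s' \<and> s' 2 = s 2 \<and>
    s' 4 = s 4 \<and> (\<forall>i<d. s' 5 i = s 5 i))"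
proof -
  define x L where "x = s 5 d" and "L = bitlen x"
  have L: "0 < L" "L \<le> M" "length (bin x) = L"
    using M bitlen_pos unfolding L_def x_def by (simp_all add: bitlen_def)
  \<comment> \<open>The tabulation goes on while the next power is at most \<open>x\<close> and
    stops at exponent \<open>L - 1\<close>. For \<open>x = 0\<close> this is 0 as well, so one digit
    gets printed.\<close>
  have le: "2 ^ Suc i \<le> x" if "i < L - 1" for i
    using two_power_le_of_less_bitlen[of "Suc i" x] that by (simp add: L_def)
  have less: "x < 2 ^ L" unfolding L_def by (rule less_two_power_bitlen)
  define frame where "frame = (\<lambda>s'::memory. s' 2 = s 2 \<and> s' 4 = s 4 \<and> (\<forall>i<d. s' 5 i = s 5 i))"
  define I where "I = (\<lambda>i (s'::memory). has_output w s' \<and> frame s' \<and> s' 5 d = x \<and> s' 5 (d + 1) = i \<and>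
    (\<forall>l\<le>i. s' 6 l = 2 ^ l))"
  define J where "J = (\<lambda>i (s'::memory). has_output (w @ take i (bin x)) s' \<and> frame s' \<and>
    s' 5 d = x mod 2 ^ (L - i) \<and> s' 5 (d + 1) = L - i \<and> (\<forall>l<L. s' 6 l = 2 ^ l))"
  \<comment> \<open>The counter has already been decremented here and is the exponent of the digit
    to be printed.\<close>
  have J: "reaches M (Cond (Minus (Plus (stack d) (Const 1)) (Cell 6 (stack (d + 1))))
      (Seq (put One) (set_stack d (Minus (stack d) (Cell 6 (stack (d + 1)))))) (put Zero))
      (s1(5 := (s1 5)(d + 1 := L - i - 1))) (J (Suc i))" if J: "J i s1" and i: "i < L" for i s1
  proof -
    define j where "j = L - i - 1"
    have j: "L - i = Suc j" "L - Suc i = j" "j < L" using i by (auto simp: j_def)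
    have bit: "take (Suc i) (bin x) = take i (bin x) @ [if even (x div 2 ^ j) then Zero else One]"
      using nth_bin[of i x] i L(3) by (simp add: take_Suc_conv_app_nth j_def flip: L_def)
    have mod: "x mod 2 ^ Suc j = (if even (x div 2 ^ j) then 0 else 2 ^ j) + x mod 2 ^ j"
      by (rule mod_two_power_Suc)
    \<comment> \<open>The remainder is below \<open>2 ^ Suc j\<close>, so comparing it with
      \<open>2 ^ j\<close> reveals its leading digit.\<close>
    have test: "2 ^ j \<le> x mod 2 ^ Suc j \<longleftrightarrow> odd (x div 2 ^ j)"
      unfolding mod by (auto simp: not_le)
    have s1: "has_output (w @ take i (bin x)) s1" "frame s1" "s1 5 d = x mod 2 ^ Suc j"
      "\<And>l. l < L \<Longrightarrow> s1 6 l = 2 ^ l"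
      using J unfolding J_def j by auto
    have out: "has_output (w @ take i (bin x)) (s1(5 := (s1 5)(d + 1 := j)))"
      using s1(1) by (simp add: has_output_def)
    show ?thesis unfolding j_def[symmetric]
    proof (rule reaches_Cond, goal_cases)
      case 1
      then have odd: "odd (x div 2 ^ j)" using s1 j test by simp
      show ?case
        apply (rule reaches_Seq, rule reaches_put[OF out], rule reaches_Store)
        using s1 odd bit j mod unfolding J_def
        by (auto simp: has_output_def frame_def)
    next
      case 2
      then have even: "even (x div 2 ^ j)" using s1 j test by simp
      show ?case
        apply (rule reaches_put[OF out])
        using s1 even bit j mod unfolding J_def
        by (auto simp: has_output_def frame_def)
    qed
  qed
  show ?thesis
    unfolding print_def Let_def
    apply (rule reaches_Seq, rule reaches_Store)
    apply (rule reaches_Seq, rule reaches_Store)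
    apply (rule reaches_Seq)
    apply (rule reaches_While[where m = "L - 1" and I = I])
    subgoal using L by simp
    subgoal using out by (auto simp: I_def x_def has_output_def frame_def)
    subgoal for i s1
      apply (rule conjI)
      subgoal using le[of i] by (auto simp: I_def)
      apply (rule reaches_Seq, rule reaches_Store, rule reaches_Store)
      apply (auto simp: I_def has_output_def frame_def le_Suc_eq)
      done
    subgoal for s1 using less L by (auto simp: I_def simp flip: power_Suc mult_2)
    subgoal for s1
    apply (rule reaches_Seq, rule reaches_Store)
    apply (rule reaches_Seq)
    apply (rule reaches_While[where m = L and I = J])
    subgoal using L by simp
    subgoal using less L by (auto simp: I_def J_def has_output_def frame_def)
    subgoal for i s2
      apply (rule conjI)
      subgoal by (auto simp: J_def)
      apply (rule reaches_Seq, rule reaches_Store)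
      using J[of i s2] by (simp add: J_def)
    subgoal by (simp add: J_def)
    subgoal for s2
      apply (rule reaches_put[of "w @ bin x"])
      subgoal using L by (auto simp: J_def)
      using L by (auto simp: J_def frame_def x_def)
    done
  done
qed

section \<open>Statements that print lists of numbers\<close>

datatype stmt =
    Emit expr
  | For nat expr stmt
  | Then stmt stmt  (infixr ";;" 60)

fun emitted :: "(nat \<Rightarrow> nat) \<Rightarrow> stmt \<Rightarrow> (nat \<Rightarrow> nat) \<Rightarrow> nat list" where
  "emitted inp (Emit e) env = [eval inp e env]"
| "emitted inp (For v a c) env = concat (map (\<lambda>i. emitted inp c (env(v := i))) [0..<eval inp a env])"
| "emitted inp (c ;; d) env = emitted inp c env @ emitted inp d env"

text \<open>\<open>M\<close> has to bound the rounds of all loops, and printing a number takes as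
  many rounds as it has digits.\<close>

fun feasible :: "nat \<Rightarrow> (nat \<Rightarrow> nat) \<Rightarrow> stmt \<Rightarrow> (nat \<Rightarrow> nat) \<Rightarrow> bool" where
  "feasible M inp (Emit e) env = (loops_le M inp e env \<and> bitlen (eval inp e env) \<le> M)"
| "feasible M inp (For v a c) env =
     (loops_le M inp a env \<and> eval inp a env \<le> M \<and>
      (\<forall>i<eval inp a env. feasible M inp c (env(v := i))))"
| "feasible M inp (c ;; d) env = (feasible M inp c env \<and> feasible M inp d env)"

fun compile_stmt :: "stmt \<Rightarrow> nat \<Rightarrow> com" where
  "compile_stmt (Emit e) d = Seq (compile e d) (print d)"
| "compile_stmt (For v a c) d = Seq (compile a d)
     (Seq (set_stack (d + 1) (Cell 4 (Const v)))
     (Seq (Store 4 (Const v) (Const 0))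
     (Seq (While (Minus (stack d) (Cell 4 (Const v)))
        (Seq (compile_stmt c (d + 2))
             (Store 4 (Const v) (Plus (Cell 4 (Const v)) (Const 1)))))
     (Store 4 (Const v) (stack (d + 1))))))"
| "compile_stmt (c ;; c') d = Seq (compile_stmt c d) (compile_stmt c' d)"

lemma enc_nums_append: "enc_nums (xs @ ys) = enc_nums xs @ enc_nums ys"
  by (simp add: enc_nums_def)

lemma reaches_compile_stmt:
  "feasible M (s 2) c (s 4) \<Longrightarrow> has_output w s \<Longrightarrow>
   reaches M (compile_stmt c d) s (\<lambda>s'. has_output (w @ enc_nums (emitted (s 2) c (s 4))) s' \<and>
     s' 2 = s 2 \<and> s' 4 = s 4 \<and> (\<forall>i<d. s' 5 i = s 5 i))"
proof (induction c arbitrary: d s w)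
  case (Emit e)
  then have e: "loops_le M (s 2) e (s 4)" "bitlen (eval (s 2) e (s 4)) \<le> M" by auto
  show ?case unfolding compile_stmt.simps
    apply (rule reaches_Seq, rule reaches_mono[OF reaches_compile[OF e(1)]])
    subgoal for s1
      apply (rule reaches_mono[OF reaches_print[of w s1]])
      using Emit e by (auto simp: keeps_def has_output_def enc_nums_def)
    done
next
  case (For v a c)
  let ?A = "eval (s 2) a (s 4)" and ?B = "\<lambda>i. emitted (s 2) c ((s 4)(v := i))"
  have a: "loops_le M (s 2) a (s 4)" "?A \<le> M" using For.prems by auto
  define I where "I = (\<lambda>i (s'::memory). has_output (w @ enc_nums (concat (map ?B [0..<i]))) s' \<and>
     s' 2 = s 2 \<and> s' 4 = (s 4)(v := i) \<and>
     s' 5 d = ?A \<and> s' 5 (d + 1) = s 4 v \<and> (\<forall>i<d. s' 5 i = s 5 i))"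
  \<comment> \<open>The invariant is asserted for the memory after the increment of the loop
    variable that follows the body.\<close>
  have body: "reaches M (compile_stmt c (d + 2)) s1 (\<lambda>s2. s2 4 = (s 4)(v := i) \<and> I (Suc i) (s2(4 := (s 4)(v := Suc i))))"
    if "I i s1" "i < ?A" for i s1
  proof -
    have s1: "s1 2 = s 2" "s1 4 = (s 4)(v := i)"
      and o: "has_output (w @ enc_nums (concat (map ?B [0..<i]))) s1"
      using that by (auto simp: I_def)
    have "feasible M (s1 2) c (s1 4)" unfolding s1 using For.prems that(2) by simp
    from For.IH[OF this o, unfolded s1] show ?thesis
      by (rule reaches_mono)
        (use that(1) in \<open>simp add: I_def has_output_def enc_nums_append del: fun_upd_apply; simp\<close>)
  qed
  show ?case unfolding compile_stmt.simps
    apply (rule reaches_Seq, rule reaches_mono[OF reaches_compile[OF a(1)]])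
    apply (rule reaches_Seq, rule reaches_Store)
    apply (rule reaches_Seq, rule reaches_Store)
    apply (rule reaches_Seq)
    apply (rule reaches_While[where m = ?A and I = I])
    subgoal using a by simp
    subgoal using For.prems by (auto simp: keeps_def I_def has_output_def enc_nums_def)
    subgoal for s1 i s2
      apply (rule conjI)
      subgoal by (simp add: I_def)
      apply (rule reaches_Seq, rule reaches_mono[OF body], assumption, assumption)
      apply (rule reaches_Store)
      apply simp
      done
    subgoal by (auto simp: I_def)
    subgoal by (auto intro!: reaches_Store simp: has_output_def I_def)
    done
next
  case (Then c1 c2)
  then have f: "feasible M (s 2) c1 (s 4)" "feasible M (s 2) c2 (s 4)" by auto
  show ?case unfolding compile_stmt.simps
    apply (rule reaches_Seq, rule reaches_mono[OF Then.IH(1)[OF f(1) Then.prems(2)]])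
    subgoal for s1
      apply (rule reaches_mono[OF Then.IH(2)[of s1]])
      using f by (auto simp: enc_nums_append)
    done
qed

text \<open>Cells 1 and 2 of array 3 hold the read position and the index of the current number.
  Symbols have nonzero codes, so the loop stops just behind the input; \<open>3 - c\<close> is
  nonzero exactly for digits, whose value is \<open>c - 1\<close>.\<close>

definition parse :: com where
  "parse = (let c = Cell 0 (Cell 3 (Const 1)); n = Cell 3 (Const 2) in
     While c
       (Seq (Cond (Minus (Const 3) c)
          (Store 2 n (Plus (Plus (Cell 2 n) (Cell 2 n)) (Minus c (Const 1))))
          (Store 3 (Const 2) (Plus n (Const 1))))
       (Store 3 (Const 1) (Plus (Cell 3 (Const 1)) (Const 1)))))"

text \<open>A functional model of one round of \<open>parse\<close>, acting on the index of the
  current number and on array 2.\<close>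

fun parse_step :: "symbol \<Rightarrow> nat \<times> (nat \<Rightarrow> nat) \<Rightarrow> nat \<times> (nat \<Rightarrow> nat)" where
  "parse_step Sep (n, f) = (Suc n, f)"
| "parse_step c (n, f) = (n, f(n := f n + f n + (code c - 1)))"

text \<open>The default 0 agrees with the initial memory, so \<open>nth0 ns\<close> is the whole of
  array 2 after parsing.\<close>

definition nth0 :: "nat list \<Rightarrow> nat \<Rightarrow> nat" where
  "nth0 ns i = (if i < length ns then ns ! i else 0)"

lemma fold_parse_bin:
  "f n = 0 \<Longrightarrow> fold parse_step (bin x) (n, f) = (n, f(n := x))"
proof (induction x rule: less_induct)
  case (less x)
  have "fold parse_step (if x < 2 then [] else bin (x div 2)) (n, f) = (n, f(n := x div 2))"
    using less by auto
  then show ?case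
    by (subst bin.simps) (auto elim!: oddE simp: mult_2)
qed

lemma fold_parse_enc_nums:
  "fold parse_step (enc_nums ns) (0, \<lambda>i. 0) = (length ns, nth0 ns)"
proof (induction ns rule: rev_induct)
  case Nil
  then show ?case by (simp add: enc_nums_def nth0_def)
next
  case (snoc x ns)
  have "(nth0 ns)(length ns := x) = nth0 (ns @ [x])" by (auto simp: nth0_def nth_append)
  moreover have "nth0 ns (length ns) = 0" by (simp add: nth0_def)
  ultimately show ?case using snoc fold_parse_bin[of "nth0 ns" "length ns" x]
    by (simp add: enc_nums_append) (simp add: enc_nums_def)
qed

lemma reaches_parse:
  assumes "length w \<le> M" and s: "s = (\<lambda>k i. 0)(0 := cells w)"
    and w: "fold parse_step w (0, \<lambda>i. 0) = (n, f)"
  shows "reaches M parse s (\<lambda>s'. s' 2 = f \<and> s' 1 = s 1 \<and> s' 4 = s 4 \<and> s' 3 0 = 0)"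
proof -
  define P where "P i = fold parse_step (take i w) (0, \<lambda>i. 0)" for i
  have P: "P (Suc i) = parse_step (w ! i) (P i)" if "i < length w" for i
    using that by (simp add: P_def take_Suc_conv_app_nth)
  define I where "I = (\<lambda>i (s'::memory). s' 3 1 = i \<and> s' 3 2 = fst (P i) \<and> s' 2 = snd (P i) \<and>
    s' 0 = s 0 \<and> s' 1 = s 1 \<and> s' 4 = s 4 \<and> s' 3 0 = 0)"
  show ?thesis unfolding parse_def Let_def
    apply (rule reaches_While[where m = "length w" and I = I])
    subgoal by (rule assms)
    subgoal by (simp add: I_def P_def s)
    subgoal for i s1
      apply (rule conjI)
      subgoal by (cases "w ! i") (auto simp: I_def s cells_def)
      apply (cases "P i"; cases "w ! i")
      by (auto intro!: reaches_Seq reaches_Cond reaches_Store simp: I_def P s cells_def)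
    subgoal by (simp add: I_def s cells_def)
    subgoal using w by (simp add: I_def P_def)
    done
qed

definition program :: "stmt \<Rightarrow> com" where
  "program c = Seq parse (compile_stmt c 0)"

text \<open>
  The first factor of the time bounds the number of steps. The initial contents of the memory are at
  most \<open>2\<^sup>2\<close>, whence the summand 2 in the cost of a step.
\<close>

lemma computes_within_program:
  assumes "length (enc_nums ns) \<le> M" "feasible M (nth0 ns) c (\<lambda>i. 0)"
    and "K = csize (program c)"
  shows "computes_within (program c) (enc_nums ns) (enc_nums (emitted (nth0 ns) c (\<lambda>i. 0)))
    ((M + 2) ^ K * ((2 + K * (M + 2) ^ K + K + 1) * K))"
proof -
  let ?s = "(\<lambda>k i. 0)(0 := cells (enc_nums ns)) :: memory"
  let ?y = "enc_nums (emitted (nth0 ns) c (\<lambda>i. 0))"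
  have "reaches M (program c) ?s (has_output ?y)"
    unfolding program_def
    apply (rule reaches_Seq)
    apply (rule reaches_mono[OF reaches_parse[OF assms(1) refl fold_parse_enc_nums]])
    subgoal for s1
      apply (rule reaches_mono[OF reaches_compile_stmt[where w = "[]" and s = s1]])
      using assms(2) by (auto simp: has_output_def cells_def)
    done
  then obtain n s' where s': "steps (program c) ?s n s'" "n \<le> step_bound M (program c)" "has_output ?y s'"
    by (auto simp: reaches_def)
  have cell: "?s k i \<le> 2 ^ 2" for k i
  proof -
    have "code x \<le> 4" for x by (cases x) auto
    then show ?thesis by (simp add: cells_def)
  qed
  have "csize (program c) \<le> K" using assms(3) by simp
  from steps_imp_exec[OF s'(1) this cell] obtain t where
    t: "exec (program c) ?s t s'" "t \<le> n * ((2 + K * n + K + 1) * K)" by blast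
  have n: "n \<le> (M + 2) ^ K" using s'(2) step_bound_le[of M "program c"] assms(3) by simp
  have "n * ((2 + K * n + K + 1) * K) \<le> (M + 2) ^ K * ((2 + K * (M + 2) ^ K + K + 1) * K)"
    using n by (intro mult_mono add_mono) auto
  with t have "t \<le> (M + 2) ^ K * ((2 + K * (M + 2) ^ K + K + 1) * K)" by (rule_tac order_trans)
  with t(1) s'(3) show ?thesis unfolding computes_within_def has_output_def by blast
qed

section \<open>The knapsack instance\<close>

text \<open>The lowest digit is the residue modulo \<open>b\<close>; the rest follows after
  cancelling \<open>b\<close>. This recovers all digit sums of a group from a single tight
  constraint.\<close>

lemma base_expansion_unique:
  fixes b :: nat
  assumes "\<And>k. k < n \<Longrightarrow> f k < b" "\<And>k. k < n \<Longrightarrow> g k < b"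
    and "(\<Sum>k<n. b ^ k * f k) = (\<Sum>k<n. b ^ k * g k)" "k < n"
  shows "f k = g k"
  using assms
proof (induction n arbitrary: f g k)
  case 0
  then show ?case by simp
next
  case (Suc n)
  have split: "(\<Sum>k<Suc n. b ^ k * h k) = h 0 + b * (\<Sum>k<n. b ^ k * h (Suc k))" for h :: "nat \<Rightarrow> nat"
    by (subst sum.lessThan_Suc_shift) (simp add: sum_distrib_left mult.assoc)
  have eq: "f 0 + b * (\<Sum>k<n. b ^ k * f (Suc k)) = g 0 + b * (\<Sum>k<n. b ^ k * g (Suc k))"
    using Suc.prems(3) unfolding split .
  have b: "f 0 < b" "g 0 < b" using Suc.prems(1,2) by auto
  have "f 0 = (f 0 + b * (\<Sum>k<n. b ^ k * f (Suc k))) mod b" using b by simp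
  also have "\<dots> = g 0" unfolding eq using b by simp
  finally have 0: "f 0 = g 0" .
  with eq b have "(\<Sum>k<n. b ^ k * f (Suc k)) = (\<Sum>k<n. b ^ k * g (Suc k))" by simp
  from Suc.IH[OF _ _ this] Suc.prems have "f (Suc k') = g (Suc k')" if "k' < n" for k'
    using that by (simp add: Suc_less_eq)
  with 0 Suc.prems(4) show ?case by (cases k) auto
qed

text \<open>
  The instance is given by indices: vertices \<open>v < n\<close>, edges \<open>e < E\<close> from \<open>tail e\<close> to \<open>head e\<close>, and
  symbols \<open>x < s\<close>; the functions at the two ends of the edge \<open>e\<close> are \<open>p e\<close> and \<open>q e\<close>. The vertices
  \<open>k < n\<close> and the edges \<open>n + e\<close> are the \<open>T\<close> objects, of which \<open>F\<close> consecutive ones form a group.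
  Item \<open>v * s + x\<close> stands for the assignment of \<open>x\<close> to \<open>v\<close>.
\<close>

locale reduction =
  fixes n E F s m :: nat and tail head :: "nat \<Rightarrow> nat" and p q :: "nat \<Rightarrow> nat \<Rightarrow> nat"
  assumes F: "0 < F"
    and tail: "e < E \<Longrightarrow> tail e < n" and head: "e < E \<Longrightarrow> head e < n"
    and tail_head: "e < E \<Longrightarrow> tail e \<noteq> head e"
    and p_le: "e < E \<Longrightarrow> x < s \<Longrightarrow> p e x \<le> m" and q_le: "e < E \<Longrightarrow> x < s \<Longrightarrow> q e x \<le> m"
    and m: "0 < m"
begin

definition T :: nat where "T = n + E"

text \<open>The definitions use only sums, products, powers of 2, comparisons and truncated
  differences, so that they can be transcribed into the expression language. Hence the groups are
  counted without division.\<close>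

definition D :: nat where "D = (\<Sum>i<T. of_bool (i * F < T))"

definition ingroup :: "nat \<Rightarrow> nat \<Rightarrow> nat" where
  "ingroup g k = of_bool (g * F \<le> k) * of_bool (k < g * F + F)"

definition inc :: "nat \<Rightarrow> nat \<Rightarrow> nat" where
  "inc k v = of_bool (k < n) * of_bool (k = v) +
     of_bool (n \<le> k) * (of_bool (tail (k - n) = v) + of_bool (head (k - n) = v))"

definition dig :: "nat \<Rightarrow> nat \<Rightarrow> nat \<Rightarrow> nat" where
  "dig k v x = of_bool (k < n) * of_bool (k = v) +
     of_bool (n \<le> k) * (of_bool (tail (k - n) = v) * p (k - n) x +
       of_bool (head (k - n) = v) * (m - q (k - n) x))"

text \<open>The number of incidences that an object receives from a full assignment: one for a
  vertex, two for an edge.\<close>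

definition cap :: "nat \<Rightarrow> nat" where
  "cap k = 1 + of_bool (n \<le> k)"

definition tgt :: "nat \<Rightarrow> nat" where
  "tgt k = of_bool (k < n) + of_bool (n \<le> k) * m"

text \<open>The base is \<open>2 ^ bits\<close>; it exceeds \<open>2 * T * m\<close>, a bound for the digit sums in a tight group.\<close>

definition bits :: nat where "bits = T + m + 1"

text \<open>The weight of the position above all objects. It dominates the weighted digit of one
  incidence, so the differences in \<open>high_cost\<close> (for symbols below \<open>s\<close>) and
  \<open>high_budget\<close> are not truncated.\<close>

definition W :: nat where "W = 2 ^ (T * bits)"

definition low_cost :: "nat \<Rightarrow> nat \<Rightarrow> nat \<Rightarrow> nat" where
  "low_cost g v x = (\<Sum>k<T. ingroup g k * (dig k v x * 2 ^ (k * bits)))"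

definition high_cost :: "nat \<Rightarrow> nat \<Rightarrow> nat \<Rightarrow> nat" where
  "high_cost g v x = (\<Sum>k<T. ingroup g k * inc k v) * W - low_cost g v x"

definition low_budget :: "nat \<Rightarrow> nat" where
  "low_budget g = (\<Sum>k<T. ingroup g k * (tgt k * 2 ^ (k * bits)))"

definition high_budget :: "nat \<Rightarrow> nat" where
  "high_budget g = (\<Sum>k<T. ingroup g k * cap k) * W - low_budget g"

definition worth :: "nat \<Rightarrow> nat" where
  "worth v = (\<Sum>k<T. inc k v)"

definition K :: "nat knapsack" where
  "K = \<lparr>items = {..<n * s}, profit = (\<lambda>i. worth (i div s)), dim = 2 * D,
     cost = (\<lambda>i j. if j \<le> D then low_cost (j - 1) (i div s) (i mod s)
        else high_cost (j - D - 1) (i div s) (i mod s)),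
     budget = (\<lambda>j. if j \<le> D then low_budget (j - 1) else high_budget (j - D - 1))\<rparr>"

section \<open>The number of groups and the size of the weights\<close>

lemma D_eq: "D = (T + F - 1) div F"
proof -
  have "{i. i < T \<and> i * F < T} = {..<(T + F - 1) div F}"
  proof (intro set_eqI iffI)
    fix i assume "i \<in> {i. i < T \<and> i * F < T}"
    then have "i * F < T" by simp
    then have "Suc i * F \<le> T + F - 1" unfolding mult_Suc by linarith
    then have "Suc i \<le> (T + F - 1) div F" using F by (simp add: less_eq_div_iff_mult_less_eq)
    then show "i \<in> {..<(T + F - 1) div F}" by simp
  next
    fix i assume "i \<in> {..<(T + F - 1) div F}"
    then have "Suc i \<le> (T + F - 1) div F" by simp
    then have "Suc i * F \<le> T + F - 1" using F by (simp add: less_eq_div_iff_mult_less_eq)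
    then have "i * F < T" using F by simp
    \<comment> \<open>As \<open>F\<close> is positive, the range \<open>i < T\<close> of the count
      cuts off nothing.\<close>
    moreover have "i \<le> i * F" using F by simp
    ultimately have "i < T" by (metis le_less_trans)
    with \<open>i * F < T\<close> show "i \<in> {i. i < T \<and> i * F < T}" by simp
  qed
  then have "card {i. i < T \<and> i * F < T} = (T + F - 1) div F" by simp
  moreover have "D = card {i. i < T \<and> i * F < T}"
    unfolding D_def by (simp add: sum.If_cases of_bool_def Int_def)
  ultimately show ?thesis by simp
qed

lemma D_ceiling: "D = nat \<lceil>real T / real F\<rceil>"
proof -
  have "D * F \<le> T + F - 1" "T + F - 1 < D * F + F"
    unfolding D_eq by (rule div_times_less_eq_dividend)
      (use F in \<open>metis dividend_less_div_times add.commute\<close>)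
  then have "D * F < T + F" "T \<le> D * F" using F by linarith+
  then have "real D * real F < real T + real F" "real T \<le> real D * real F"
    unfolding of_nat_mult[symmetric] of_nat_add[symmetric] of_nat_less_iff of_nat_le_iff .
  then have "\<lceil>real T / real F\<rceil> = int D" using F by (intro ceiling_unique) (simp_all add: field_simps)
  then show ?thesis by simp
qed

lemma ingroup_iff: "ingroup g k = of_bool (g = k div F)"
proof -
  have "g = k div F \<longleftrightarrow> g * F \<le> k \<and> k < g * F + F"
    using F by (simp add: div_nat_eqI mult.commute add.commute eq_commute[of g])
      (metis div_nat_eqI mult.commute mult_Suc div_times_less_eq_dividend dividend_less_times_div)
  then show ?thesis by (simp add: ingroup_def flip: of_bool_conj)
qed

lemma group_less: "k < T \<Longrightarrow> k div F < D"
proof -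
  assume "k < T"
  then have "k + F \<le> T + F - 1" by simp
  from div_le_mono[OF this, of F] show ?thesis using F by (simp add: D_eq)
qed

lemma sum_groups: "(\<Sum>g<D. \<Sum>k<T. ingroup g k * f k) = (\<Sum>k<T. f k)"
  by (subst sum.swap) (auto simp: ingroup_iff group_less intro!: sum.cong)

lemma dig_le: "k < T \<Longrightarrow> x < s \<Longrightarrow> dig k v x \<le> inc k v * m"
proof (cases "k < n")
  case True
  then show ?thesis using m by (simp add: dig_def inc_def)
next
  case False
  assume "k < T" "x < s"
  with False have "k - n < E" by (auto simp: T_def)
  with p_le[OF this \<open>x < s\<close>] tail_head[OF this] False show ?thesis
    by (auto simp: dig_def inc_def)
qed

lemma tgt_le: "tgt k \<le> cap k * m"
  using m by (auto simp: tgt_def cap_def)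

lemma less_power_bits: "m < 2 ^ bits"
  using less_exp[of bits] by (simp add: bits_def)

text \<open>One digit of at most \<open>m\<close> is below the base, so at position \<open>k\<close>
  it weighs no more than the next position, which is at most \<open>T\<close>.\<close>

lemma weight_le: "k < T \<Longrightarrow> a \<le> b * m \<Longrightarrow> a * 2 ^ (k * bits) \<le> b * W"
proof -
  assume k: "k < T" and "a \<le> b * m"
  then have "a * 2 ^ (k * bits) \<le> b * m * 2 ^ (k * bits)" by simp
  also have "\<dots> \<le> b * (2 ^ bits * 2 ^ (k * bits))" using less_power_bits by simp
  also have "\<dots> = b * 2 ^ (Suc k * bits)" by (simp add: power_add)
  also have "\<dots> \<le> b * W" unfolding W_def using k
    by (intro mult_left_mono power_increasing mult_right_mono) auto
  finally show ?thesis .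
qed

lemma low_cost_le: "x < s \<Longrightarrow> low_cost g v x \<le> (\<Sum>k<T. ingroup g k * inc k v) * W"
  unfolding low_cost_def sum_distrib_right
  by (intro sum_mono) (simp add: mult.assoc weight_le dig_le)

lemma low_budget_le: "low_budget g \<le> (\<Sum>k<T. ingroup g k * cap k) * W"
  unfolding low_budget_def sum_distrib_right
  by (intro sum_mono) (simp add: mult.assoc weight_le tgt_le)

lemma sum_dims:
  "(\<forall>j\<in>{1..2 * D}. P j) \<longleftrightarrow> (\<forall>g<D. P (Suc g)) \<and> (\<forall>g<D. P (Suc (D + g)))"
proof -
  have "\<exists>g<D. j = Suc g \<or> j = Suc (D + g)" if "j \<in> {1..2 * D}" for j
  proof (cases "j \<le> D")
    case True
    then show ?thesis using that by (intro exI[of _ "j - 1"]) auto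
  next
    case False
    then show ?thesis using that by (intro exI[of _ "j - D - 1"]) auto
  qed
  then show ?thesis by fastforce
qed

lemma is_solution_iff:
  "is_solution K S \<longleftrightarrow> S \<subseteq> {..<n * s} \<and>
     (\<forall>g<D. (\<Sum>i\<in>S. low_cost g (i div s) (i mod s)) \<le> low_budget g) \<and>
     (\<forall>g<D. (\<Sum>i\<in>S. high_cost g (i div s) (i mod s)) \<le> high_budget g)"
  unfolding is_solution_def K_def knapsack.simps sum_dims by simp

lemma item_div_mod: "x < s \<Longrightarrow> (v * s + x) div s = v \<and> (v * s + x) mod s = x"
  by auto

lemma item_bounds: "i < n * s \<Longrightarrow> i div s < n \<and> i mod s < s"
  by (cases "s = 0") (auto simp: less_mult_imp_div_less)

lemma sum_cap: "(\<Sum>k<T. cap k) = n + 2 * E"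
proof -
  have "{k. k < n + E \<and> n \<le> k} = {n..<n + E}" by auto
  then have "(\<Sum>k<n + E. of_bool (n \<le> k)) = E"
    by (simp add: of_bool_def sum.If_cases Int_def)
  then show ?thesis by (simp add: cap_def T_def sum_Suc)
qed

lemma sum_inc: "k < T \<Longrightarrow> (\<Sum>v<n. inc k v) = cap k"
  using tail[of "k - n"] head[of "k - n"]
  by (auto simp: inc_def cap_def T_def sum.distrib simp flip: sum_distrib_left)

text \<open>The items of a consistent full assignment meet the target of every object exactly, so
  all constraints hold with equality, and the profit is the number of all incidences.\<close>

lemma completeness:
  assumes f: "\<And>v. v < n \<Longrightarrow> f v < s"
    and consistent: "\<And>e. e < E \<Longrightarrow> p e (f (tail e)) = q e (f (head e))"
  shows "\<exists>S. is_solution K S \<and> total_profit K S = n + 2 * E"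
proof -
  define S where "S = (\<lambda>v. v * s + f v) ` {..<n}"
  have inj: "inj_on (\<lambda>v. v * s + f v) {..<n}"
    by (rule inj_on_inverseI[where g = "\<lambda>i. i div s"]) (simp add: f item_div_mod)
  have sum_S: "(\<Sum>i\<in>S. h (i div s) (i mod s)) = (\<Sum>v<n. h v (f v))" for h :: "nat \<Rightarrow> nat \<Rightarrow> nat"
    unfolding S_def sum.reindex[OF inj] by (intro sum.cong) (simp_all add: f item_div_mod)
  have sum_dig: "(\<Sum>v<n. dig k v (f v)) = tgt k" if k: "k < T" for k
  proof (cases "k < n")
    case True
    then show ?thesis by (simp add: dig_def tgt_def)
  next
    case False
    define e where "e = k - n"
    have e: "e < E" "k = n + e" using k False by (auto simp: e_def T_def)
    have "(\<Sum>v<n. dig k v (f v)) = p e (f (tail e)) + (m - q e (f (head e)))"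
      using tail[OF e(1)] head[OF e(1)] e(2)
      by (simp add: dig_def sum.distrib of_bool_def if_distrib[of "\<lambda>x. x * _"] cong: if_cong)
    \<comment> \<open>By \<open>q_le\<close> the difference \<open>m - q\<close> is not truncated,
      so consistency turns the sum into \<open>m\<close>.\<close>
    then show ?thesis
      using consistent[OF e(1)] q_le[OF e(1) f[OF head[OF e(1)]]] e(2) by (simp add: tgt_def)
  qed
  have low: "(\<Sum>v<n. low_cost g v (f v)) = low_budget g" for g
    unfolding low_cost_def low_budget_def
    by (subst sum.swap) (simp add: sum_dig flip: sum_distrib_left sum_distrib_right)
  \<comment> \<open>Low and high cost of an item add up to \<open>W\<close> per incidence in the
    group, so equality passes from the low dimension to the high one.\<close>
  have "(\<Sum>v<n. high_cost g v (f v)) + (\<Sum>v<n. low_cost g v (f v)) =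
      (\<Sum>v<n. (\<Sum>k<T. ingroup g k * inc k v) * W)" for g
    unfolding sum.distrib[symmetric] high_cost_def
    by (intro sum.cong) (simp_all add: low_cost_le f)
  also have "(\<Sum>v<n. (\<Sum>k<T. ingroup g k * inc k v) * W) = (\<Sum>k<T. ingroup g k * cap k) * W" for g
    unfolding sum_distrib_right[symmetric]
    by (subst sum.swap) (simp add: sum_inc flip: sum_distrib_left)
  finally have high: "(\<Sum>v<n. high_cost g v (f v)) = high_budget g" for g
    unfolding low high_budget_def by (metis add_diff_cancel_right')
  have "v * s + f v < n * s" if "v < n" for v
  proof -
    have "v * s + f v < Suc v * s" using f[OF that] by simp
    also have "\<dots> \<le> n * s" using that by (intro mult_right_mono) auto
    finally show ?thesis .
  qed
  then have "is_solution K S" unfolding is_solution_iff sum_S low high by (auto simp: S_def)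
  moreover have "total_profit K S = (\<Sum>v<n. worth v)"
    unfolding total_profit_def K_def knapsack.simps by (rule sum_S)
  moreover have "(\<Sum>v<n. worth v) = (\<Sum>k<T. cap k)"
    unfolding worth_def by (subst sum.swap) (simp add: sum_inc)
  ultimately show ?thesis using sum_cap by auto
qed

text \<open>\<open>r\<close> allows for the missing profit, \<open>R\<close> is the set of surviving
  vertices, and \<open>f\<close> gives their symbols. The bounds are written with additions because
  subtraction on naturals truncates.\<close>

lemma soundness:
  assumes S: "is_solution K S" and r: "n + 2 * E \<le> total_profit K S + r"
  shows "\<exists>R f. R \<subseteq> {..<n} \<and> n \<le> card R + r * F \<and> (\<forall>v\<in>R. f v < s) \<and>
    (\<forall>e<E. tail e \<in> R \<and> head e \<in> R \<longrightarrow> p e (f (tail e)) = q e (f (head e)))"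
proof -
  let ?v = "\<lambda>i. i div s" and ?x = "\<lambda>i. i mod s"
  have sub: "S \<subseteq> {..<n * s}" and fin: "finite S"
    and low: "\<And>g. g < D \<Longrightarrow> (\<Sum>i\<in>S. low_cost g (?v i) (?x i)) \<le> low_budget g"
    and high: "\<And>g. g < D \<Longrightarrow> (\<Sum>i\<in>S. high_cost g (?v i) (?x i)) \<le> high_budget g"
    using S unfolding is_solution_iff by (auto intro: finite_subset)
  have vx: "?v i < n" "?x i < s" if "i \<in> S" for i
    using item_bounds[of i] sub that by auto
  define a where "a g = (\<Sum>k<T. ingroup g k * (\<Sum>i\<in>S. inc k (?v i)))" for g
  define A where "A g = (\<Sum>k<T. ingroup g k * cap k)" for g
  have cost_sum: "(\<Sum>i\<in>S. low_cost g (?v i) (?x i)) + (\<Sum>i\<in>S. high_cost g (?v i) (?x i)) = a g * W" for g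
  proof -
    have "(\<Sum>i\<in>S. low_cost g (?v i) (?x i)) + (\<Sum>i\<in>S. high_cost g (?v i) (?x i)) =
       (\<Sum>i\<in>S. (\<Sum>k<T. ingroup g k * inc k (?v i)) * W)"
      unfolding sum.distrib[symmetric] high_cost_def
      by (intro sum.cong) (simp_all add: low_cost_le vx)
    also have "\<dots> = a g * W"
      unfolding a_def sum_distrib_right[symmetric] sum_distrib_left by (subst sum.swap) simp
    finally show ?thesis .
  qed
  have budget_sum: "low_budget g + high_budget g = A g * W" for g
    unfolding high_budget_def A_def by (simp add: low_budget_le)
  have W: "0 < W" by (simp add: W_def)
  have a_le: "a g \<le> A g" if "g < D" for g
    using cost_sum[of g] budget_sum[of g] low[OF that] high[OF that] W
    by (metis add_mono mult_le_cancel2)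
  \<comment> \<open>\<open>a g\<close> is the profit earned in the group \<open>g\<close>, and the sum of the two constraints gives \<open>a g \<le> A g\<close>.\<close>
  define tight where "tight g \<longleftrightarrow> a g = A g" for g
  \<comment> \<open>If the sums of both sides of two inequalities agree, neither inequality is
    strict.\<close>
  have low_eq: "(\<Sum>i\<in>S. low_cost g (?v i) (?x i)) = low_budget g" if "g < D" "tight g" for g
  proof -
    have "a g * W = A g * W" using that(2) by (simp add: tight_def)
    then show ?thesis
      using cost_sum[of g] budget_sum[of g] low[OF that(1)] high[OF that(1)] by linarith
  qed
  \<comment> \<open>In a tight group no carry occurs, as the digits of \<open>A g\<close> incidences sum to at most \<open>A g * m < 2 ^ bits\<close>.\<close>
  have dig_eq: "(\<Sum>i\<in>S. dig k (?v i) (?x i)) = tgt k" if k: "k < T" and t: "tight (k div F)" for k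
  proof -
    let ?g = "k div F"
    have g: "?g < D" using k by (rule group_less)
    have A_less: "A ?g * m < 2 ^ bits"
    proof -
      have "A ?g \<le> 2 * T" unfolding A_def
        by (rule order_trans[OF sum_bounded_above[of _ _ 2]]) (auto simp: ingroup_iff cap_def)
      moreover have "T < 2 ^ T" "m < 2 ^ m" by simp_all
      then have "T * m < 2 ^ T * 2 ^ m" by (rule mult_strict_mono') auto
      moreover have "A ?g * m \<le> 2 * (T * m)"
        using mult_le_mono1[OF \<open>A ?g \<le> 2 * T\<close>, of m] by simp
      moreover have "2 ^ bits = 2 * (2 ^ T * (2::nat) ^ m)" by (simp add: bits_def power_add)
      ultimately show ?thesis by linarith
    qed
    \<comment> \<open>Objects outside the group get digit 0 on both sides, so the expansions range
      over all positions.\<close>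
    define f where "f k = ingroup ?g k * (\<Sum>i\<in>S. dig k (?v i) (?x i))" for k
    define h where "h k = ingroup ?g k * tgt k" for k
    \<comment> \<open>A digit sum is at most \<open>m\<close> per incidence, and one object has no
      more incidences than its whole group; so the bound for the group controls every digit.\<close>
    have "f k \<le> ingroup ?g k * (\<Sum>i\<in>S. inc k (?v i)) * m" if "k < T" for k
      unfolding f_def mult.assoc sum_distrib_right
      by (intro mult_left_mono sum_mono dig_le that vx) auto
    moreover have "ingroup ?g k * (\<Sum>i\<in>S. inc k (?v i)) \<le> a ?g" if "k < T" for k
      unfolding a_def by (rule member_le_sum) (use that in auto)
    ultimately have "f k \<le> a ?g * m" if "k < T" for k
      by (meson le_trans mult_le_mono1 that)
    then have f: "f k < 2 ^ bits" if "k < T" for k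
      using A_less t that unfolding tight_def by (metis le_less_trans)
    have "ingroup ?g k * cap k \<le> A ?g" if "k < T" for k
      unfolding A_def by (rule member_le_sum) (use that in auto)
    moreover have "h k \<le> ingroup ?g k * cap k * m" for k
      unfolding h_def mult.assoc by (intro mult_left_mono tgt_le) auto
    ultimately have h: "h k < 2 ^ bits" if "k < T" for k
      using A_less that by (meson le_less_trans le_trans mult_le_mono1)
    have "(\<Sum>i\<in>S. low_cost ?g (?v i) (?x i)) = (\<Sum>k<T. (2 ^ bits) ^ k * f k)"
      unfolding low_cost_def f_def
      by (subst sum.swap)
        (simp add: sum_distrib_left sum_distrib_right mult.commute mult.left_commute flip: power_mult)
    moreover have "low_budget ?g = (\<Sum>k<T. (2 ^ bits) ^ k * h k)"
      unfolding low_budget_def h_def by (simp add: ac_simps flip: power_mult)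
    ultimately have "(\<Sum>k<T. (2 ^ bits) ^ k * f k) = (\<Sum>k<T. (2 ^ bits) ^ k * h k)"
      using low_eq[OF g t] by simp
    from base_expansion_unique[OF f h this k] show ?thesis by (simp add: f_def h_def ingroup_iff)
  qed
  define damaged where "damaged = {g. g < D \<and> \<not> tight g}"
  have "total_profit K S = (\<Sum>g<D. a g)"
  proof -
    have "total_profit K S = (\<Sum>k<T. \<Sum>i\<in>S. inc k (?v i))"
      unfolding total_profit_def K_def knapsack.simps worth_def by (rule sum.swap)
    then show ?thesis unfolding a_def sum_groups .
  qed
  moreover have "n + 2 * E = (\<Sum>g<D. A g)" unfolding A_def sum_groups sum_cap ..
  \<comment> \<open>Profits are integers, so a group below its maximum misses at least one
    unit.\<close>
  moreover have "a g + of_bool (\<not> tight g) \<le> A g" if "g < D" for g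
    using a_le[OF that] by (auto simp: tight_def)
  then have "(\<Sum>g<D. a g + of_bool (\<not> tight g)) \<le> (\<Sum>g<D. A g)"
    by (intro sum_mono) simp
  moreover have "(\<Sum>g<D. of_bool (\<not> tight g)) = card damaged"
    by (simp add: damaged_def of_bool_def sum.If_cases Int_def)
  ultimately have damaged: "card damaged \<le> r" using r by (simp add: sum.distrib)
  \<comment> \<open>For an edge in a damaged group it suffices to give up its tail.\<close>
  define R where "R = {v. v < n \<and> tight (v div F) \<and> (\<forall>e<E. tail e = v \<longrightarrow> tight ((n + e) div F))}"
  \<comment> \<open>The vertex given up for an object. The last group may reach beyond
    \<open>T\<close>; the images of such indices only enlarge the covering set, whose cardinality
    bound counts them anyway.\<close>
  define obj where "obj k = (if k < n then k else tail (k - n))" for k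
  have "{..<n} - R \<subseteq> obj ` (\<Union>g\<in>damaged. {g * F..<g * F + F})"
  proof
    fix v assume v: "v \<in> {..<n} - R"
    then consider "\<not> tight (v div F)" | e where "e < E" "tail e = v" "\<not> tight ((n + e) div F)"
      by (auto simp: R_def)
    then obtain k where k: "k < T" "obj k = v" "\<not> tight (k div F)"
    proof cases
      case 1
      with v that[of v] show ?thesis by (auto simp: obj_def T_def)
    next
      case 2
      with that[of "n + e"] show ?thesis by (auto simp: obj_def T_def)
    qed
    then have "k div F \<in> damaged" using group_less by (simp add: damaged_def)
    moreover have "k \<in> {k div F * F..<k div F * F + F}"
      using F by (metis atLeastLessThan_iff div_times_less_eq_dividend dividend_less_div_times add.commute)
    ultimately show "v \<in> obj ` (\<Union>g\<in>damaged. {g * F..<g * F + F})" using k(2) by blast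
  qed
  then have "card ({..<n} - R) \<le> card (obj ` (\<Union>g\<in>damaged. {g * F..<g * F + F}))"
    by (intro card_mono) (auto simp: damaged_def)
  also have "\<dots> \<le> card (\<Union>g\<in>damaged. {g * F..<g * F + F})"
    by (rule card_image_le) (auto simp: damaged_def)
  also have "\<dots> \<le> (\<Sum>g\<in>damaged. card {g * F..<g * F + F})"
    by (rule card_UN_le) (auto simp: damaged_def)
  also have "\<dots> \<le> r * F" using damaged by simp
  finally have "n - card R \<le> r * F" by (subst (asm) card_Diff_subset) (auto simp: R_def)
  then have card: "n \<le> card R + r * F" by simp
  \<comment> \<open>The digit sum of a vertex counts its chosen items, and the target 1 leaves
    exactly one.\<close>
  have unique: "\<exists>i. {i \<in> S. ?v i = v} = {i}" if "v \<in> R" for v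
  proof -
    have "v < n" "tight (v div F)" using that by (auto simp: R_def)
    with dig_eq[of v] have "(\<Sum>i\<in>S. of_bool (?v i = v)) = (1::nat)"
      by (simp add: dig_def tgt_def T_def eq_commute)
    then have "card {i \<in> S. ?v i = v} = 1"
      using fin by (simp add: of_bool_def sum.If_cases Int_def)
    then show ?thesis by (simp add: card_1_singleton_iff)
  qed
  then obtain it where it: "\<And>v. v \<in> R \<Longrightarrow> {i \<in> S. ?v i = v} = {it v}" by metis
  define f where "f v = it v mod s" for v
  have sum_it: "(\<Sum>i\<in>S. of_bool (v = ?v i) * h (?x i)) = h (f v)" if "v \<in> R" for v and h :: "nat \<Rightarrow> nat"
  proof -
    have "(\<Sum>i\<in>S. of_bool (v = ?v i) * h (?x i)) = (\<Sum>i\<in>{i \<in> S. ?v i = v}. h (?x i))"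
      using fin by (intro sum.mono_neutral_cong_right) auto
    then show ?thesis using it[OF that] by (simp add: f_def)
  qed
  have "f v < s" if "v \<in> R" for v
  proof -
    have "it v \<in> S" using it[OF that] by blast
    then show ?thesis unfolding f_def by (rule vx)
  qed
  moreover have "p e (f (tail e)) = q e (f (head e))" if e: "e < E" "tail e \<in> R" "head e \<in> R" for e
  proof -
    \<comment> \<open>Survival of the tail makes the group of the edge tight; since both ends
      survive, each contributes exactly one term to the digit sum.\<close>
    have "tight ((n + e) div F)" using e by (auto simp: R_def)
    with dig_eq[of "n + e"] e(1) have "(\<Sum>i\<in>S. of_bool (tail e = ?v i) * p e (?x i) +
       of_bool (head e = ?v i) * (m - q e (?x i))) = m"
      by (simp add: dig_def tgt_def T_def)
    then have "p e (f (tail e)) + (m - q e (f (head e))) = m"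
      using sum_it[OF e(2), of "p e"] sum_it[OF e(3), of "\<lambda>x. m - q e x"] by (simp add: sum.distrib)
    moreover have "q e (f (head e)) \<le> m" using q_le e(1) \<open>\<And>v. v \<in> R \<Longrightarrow> f v < s\<close>[OF e(3)] by simp
    ultimately show ?thesis by linarith
  qed
  moreover have "R \<subseteq> {..<n}" by (auto simp: R_def)
  ultimately show ?thesis using card by blast
qed

end

section \<open>The program of the reduction\<close>

text \<open>The input list is: \<open>F\<close>; \<open>n\<close> and the vertex names;
  \<open>E\<close> and two ends per edge; \<open>s\<close> and the symbols; \<open>m\<close> and the
  numbers up to \<open>m\<close>; finally the tables. Each length is found behind the preceding
  block.\<close>

definition n_expr :: expr where "n_expr = Inp (Num 1)"
definition F_expr :: expr where "F_expr = Inp (Num 0)"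
definition E_expr :: expr where "E_expr = Inp (Add n_expr (Num 2))"
definition s_expr :: expr where "s_expr = Inp (Add (Add n_expr (Num 3)) (Add E_expr E_expr))"
definition m_expr :: expr where
  "m_expr = Inp (Add (Add (Add n_expr (Num 4)) (Add E_expr E_expr)) s_expr)"
definition table_expr :: expr where
  "table_expr = Add (Add (Add (Add n_expr (Num 5)) (Add E_expr E_expr)) s_expr) m_expr"
definition T_expr :: expr where "T_expr = Add n_expr E_expr"
definition bits_expr :: expr where "bits_expr = Add (Add T_expr m_expr) (Num 1)"

definition le_expr :: "expr \<Rightarrow> expr \<Rightarrow> expr" where "le_expr a b = Sub (Num 1) (Sub a b)"
definition less_expr :: "expr \<Rightarrow> expr \<Rightarrow> expr" where "less_expr a b = le_expr (Add a (Num 1)) b"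
definition eq_expr :: "expr \<Rightarrow> expr \<Rightarrow> expr" where "eq_expr a b = Mul (le_expr a b) (le_expr b a)"

lemma eval_compare [simp]:
  "eval inp (le_expr a b) env = of_bool (eval inp a env \<le> eval inp b env)"
  "eval inp (less_expr a b) env = of_bool (eval inp a env < eval inp b env)"
  "eval inp (eq_expr a b) env = of_bool (eval inp a env = eval inp b env)"
  by (auto simp: le_expr_def less_expr_def eq_expr_def)

text \<open>\<open>eq_expr\<close> multiplies two indicators, hence may loop once; this explains
  \<open>0 < M\<close>.\<close>

lemma loops_le_compare [simp]:
  "loops_le M inp (le_expr a b) env \<longleftrightarrow> loops_le M inp a env \<and> loops_le M inp b env"
  "loops_le M inp (less_expr a b) env \<longleftrightarrow> loops_le M inp a env \<and> loops_le M inp b env"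
  "0 < M \<Longrightarrow> loops_le M inp (eq_expr a b) env \<longleftrightarrow> loops_le M inp a env \<and> loops_le M inp b env"
  using eval_compare(1)[of inp a b env] by (auto simp: le_expr_def less_expr_def eq_expr_def)

abbreviation "v_var \<equiv> Var 0"
abbreviation "x_var \<equiv> Var 1"
abbreviation "g_var \<equiv> Var 2"
abbreviation "k_var \<equiv> Var 3"

definition D_expr :: expr where
  "D_expr = Sum 4 T_expr (less_expr (Mul (Var 4) F_expr) T_expr)"

definition ingroup_expr :: expr where
  "ingroup_expr = Mul (le_expr (Mul g_var F_expr) k_var)
     (less_expr k_var (Add (Mul g_var F_expr) F_expr))"

definition edge_expr :: expr where "edge_expr = Sub k_var n_expr"
text \<open>The input lists vertex names, not indices, so the end of an edge is compared with the
  name stored for index \<open>v\<close>.\<close>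

definition is_tail_expr :: expr where
  "is_tail_expr =
     eq_expr (Inp (Add (Add n_expr (Num 3)) (Add edge_expr edge_expr))) (Inp (Add v_var (Num 2)))"
definition is_head_expr :: expr where
  "is_head_expr =
     eq_expr (Inp (Add (Add n_expr (Num 4)) (Add edge_expr edge_expr))) (Inp (Add v_var (Num 2)))"
text \<open>Each edge occupies \<open>2 * s\<close> table entries, first those of its tail and then
  those of its head.\<close>

definition row_expr :: expr where
  "row_expr = Add table_expr (Mul edge_expr (Add s_expr s_expr))"

definition inc_expr :: expr where
  "inc_expr = Add (Mul (less_expr k_var n_expr) (eq_expr k_var v_var))
     (Mul (le_expr n_expr k_var) (Add is_tail_expr is_head_expr))"

definition dig_expr :: expr where
  "dig_expr = Add (Mul (less_expr k_var n_expr) (eq_expr k_var v_var))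
     (Mul (le_expr n_expr k_var)
       (Add (Mul is_tail_expr (Inp (Add row_expr x_var)))
         (Mul is_head_expr (Sub m_expr (Inp (Add (Add row_expr s_expr) x_var))))))"

definition cap_expr :: expr where
  "cap_expr = Add (Num 1) (le_expr n_expr k_var)"

definition tgt_expr :: expr where
  "tgt_expr = Add (less_expr k_var n_expr) (Mul (le_expr n_expr k_var) m_expr)"

definition worth_expr :: expr where "worth_expr = Sum 3 T_expr inc_expr"

definition group_sum_expr :: "expr \<Rightarrow> expr" where
  "group_sum_expr e = Sum 3 T_expr (Mul ingroup_expr e)"
text \<open>The order of the factors matters: the first one drives the multiplication loop and must
  be small, whereas the exponentially large power is merely added.\<close>

definition weighted_expr :: "expr \<Rightarrow> expr" where
  "weighted_expr e = group_sum_expr (Mul e (Pow2 (Mul k_var bits_expr)))"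
definition complement_expr :: "expr \<Rightarrow> expr \<Rightarrow> expr" where
  "complement_expr e f =
     Sub (Mul (group_sum_expr e) (Pow2 (Mul T_expr bits_expr))) (weighted_expr f)"

definition reduction_stmt :: stmt where
  "reduction_stmt =
     Emit (Add D_expr D_expr) ;;
     Emit (Mul n_expr s_expr) ;;
     For 0 n_expr (For 1 s_expr
       (Emit (Add (Mul v_var s_expr) x_var) ;;
        Emit worth_expr ;;
        For 2 D_expr (Emit (weighted_expr dig_expr)) ;;
        For 2 D_expr (Emit (complement_expr inc_expr dig_expr)))) ;;
     For 2 D_expr (Emit (weighted_expr tgt_expr)) ;;
     For 2 D_expr (Emit (complement_expr cap_expr tgt_expr))"

text \<open>
  The sequence \<open>inp\<close> consists of \<open>F\<close> and the numbers in the encoding of the R-CSP instance; the name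
  of the vertex with index \<open>v\<close> is at position \<open>v + 2\<close>.
\<close>

locale encoded_reduction = reduction +
  fixes inp :: "nat \<Rightarrow> nat"
  assumes inp_F: "inp 0 = F" and inp_n: "inp (Suc 0) = n"
    and inp_names: "inj_on (\<lambda>v. inp (v + 2)) {..<n}"
    and inp_E: "inp (n + 2) = E"
    and inp_tail: "e < E \<Longrightarrow> inp (n + 3 + (e + e)) = inp (tail e + 2)"
    and inp_head: "e < E \<Longrightarrow> inp (n + 4 + (e + e)) = inp (head e + 2)"
    and inp_s: "inp (n + 3 + (E + E)) = s"
    and inp_m: "inp (n + 4 + (E + E) + s) = m"
    and inp_p: "e < E \<Longrightarrow> x < s \<Longrightarrow> inp (n + 5 + (E + E) + s + m + e * (s + s) + x) = p e x"
    and inp_q: "e < E \<Longrightarrow> x < s \<Longrightarrow> inp (n + 5 + (E + E) + s + m + e * (s + s) + s + x) = q e x"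
begin

section \<open>Values of the expressions and the printed list\<close>

lemma eval_parameters [simp]:
  "eval inp F_expr env = F" "eval inp n_expr env = n" "eval inp E_expr env = E"
  "eval inp s_expr env = s" "eval inp m_expr env = m" "eval inp T_expr env = T"
  "eval inp bits_expr env = bits"
proof -
  show F: "eval inp F_expr env = F" and n: "eval inp n_expr env = n"
    using inp_F inp_n by (simp_all add: F_expr_def n_expr_def)
  show E: "eval inp E_expr env = E" using inp_E n by (simp add: E_expr_def)
  show s: "eval inp s_expr env = s" unfolding s_expr_def using inp_s n E by simp
  show m: "eval inp m_expr env = m" unfolding m_expr_def using inp_m n E s by simp
  show T: "eval inp T_expr env = T" by (simp add: T_expr_def T_def n E)
  show "eval inp bits_expr env = bits" by (simp add: bits_expr_def bits_def T m)
qed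

lemma eval_D [simp]: "eval inp D_expr env = D"
  by (simp add: D_expr_def D_def)

lemma eval_ingroup [simp]: "eval inp ingroup_expr env = ingroup (env 2) (env 3)"
  by (simp add: ingroup_expr_def ingroup_def)

lemma eval_edge [simp]: "eval inp edge_expr env = env 3 - n"
  by (simp add: edge_expr_def)

lemma eval_row:
  "eval inp row_expr env = n + 5 + (E + E) + s + m + (env 3 - n) * (s + s)"
  by (simp add: row_expr_def table_expr_def)

lemma eval_is_tail_head:
  assumes "n \<le> env 3" "env 3 < T" "env 0 < n"
  shows "eval inp is_tail_expr env = of_bool (tail (env 3 - n) = env 0)"
    and "eval inp is_head_expr env = of_bool (head (env 3 - n) = env 0)"
proof -
  have e: "env 3 - n < E" using assms by (auto simp: T_def)
  have name: "inp (v + 2) = inp (env 0 + 2) \<longleftrightarrow> v = env 0" if "v < n" for v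
    using inj_on_eq_iff[OF inp_names] that assms(3) by simp
  show "eval inp is_tail_expr env = of_bool (tail (env 3 - n) = env 0)"
    unfolding is_tail_expr_def eval_compare eval.simps eval_parameters eval_edge inp_tail[OF e]
      name[OF tail[OF e]] ..
  show "eval inp is_head_expr env = of_bool (head (env 3 - n) = env 0)"
    unfolding is_head_expr_def eval_compare eval.simps eval_parameters eval_edge inp_head[OF e]
      name[OF head[OF e]] ..
qed

lemma eval_inc [simp]:
  assumes "env 3 < T" "env 0 < n"
  shows "eval inp inc_expr env = inc (env 3) (env 0)"
  \<comment> \<open>For a vertex \<open>k < n\<close> the ends are read at an irrelevant position,
    and the result is multiplied by 0.\<close>
  using eval_is_tail_head[OF _ assms] by (cases "env 3 < n") (simp_all add: inc_expr_def inc_def)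

lemma eval_dig [simp]:
  assumes "env 3 < T" "env 0 < n" "env (Suc 0) < s"
  shows "eval inp dig_expr env = dig (env 3) (env 0) (env (Suc 0))"
proof (cases "env 3 < n")
  case True
  then show ?thesis by (simp add: dig_expr_def dig_def)
next
  case False
  then have e: "env 3 - n < E" using assms by (auto simp: T_def)
  have "eval inp (Inp (Add row_expr x_var)) env = p (env 3 - n) (env (Suc 0))"
    unfolding eval.simps eval_row using inp_p[OF e assms(3)] by simp
  moreover have "eval inp (Inp (Add (Add row_expr s_expr) x_var)) env = q (env 3 - n) (env (Suc 0))"
    unfolding eval.simps eval_row eval_parameters using inp_q[OF e assms(3)] by simp
  ultimately show ?thesis
    using False eval_is_tail_head[OF _ assms(1,2)]
    by (simp add: dig_expr_def dig_def del: eval.simps(3))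
qed

lemma eval_cap [simp]: "eval inp cap_expr env = cap (env 3)"
  by (simp add: cap_expr_def cap_def)

lemma eval_tgt [simp]: "eval inp tgt_expr env = tgt (env 3)"
  by (simp add: tgt_expr_def tgt_def)

lemma eval_worth [simp]: "env 0 < n \<Longrightarrow> eval inp worth_expr env = worth (env 0)"
  by (simp add: worth_expr_def worth_def)

lemma eval_low_cost [simp]:
  "env 0 < n \<Longrightarrow> env (Suc 0) < s \<Longrightarrow>
   eval inp (weighted_expr dig_expr) env = low_cost (env 2) (env 0) (env (Suc 0))"
  by (simp add: weighted_expr_def group_sum_expr_def low_cost_def)

lemma eval_high_cost [simp]:
  "env 0 < n \<Longrightarrow> env (Suc 0) < s \<Longrightarrow>
   eval inp (complement_expr inc_expr dig_expr) env = high_cost (env 2) (env 0) (env (Suc 0))"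
  by (simp add: complement_expr_def group_sum_expr_def high_cost_def W_def)

lemma eval_low_budget [simp]:
  "eval inp (weighted_expr tgt_expr) env = low_budget (env 2)"
  by (simp add: weighted_expr_def group_sum_expr_def low_budget_def)

lemma eval_high_budget [simp]:
  "eval inp (complement_expr cap_expr tgt_expr) env = high_budget (env 2)"
  by (simp add: complement_expr_def group_sum_expr_def high_budget_def W_def)

lemma emitted_reduction_stmt: "emitted inp reduction_stmt env = knapsack_nums K"
proof -
  \<comment> \<open>The nested loops over \<open>v\<close> and \<open>x\<close> visit the items in
    increasing order, as the encoding requires.\<close>
  have items: "[0..<k * s] = concat (map (\<lambda>v. map (\<lambda>x. v * s + x) [0..<s]) [0..<k])" for k
  proof (induction k)
    case (Suc k)
    have "[0..<Suc k * s] = [0..<k * s] @ [k * s..<k * s + s]"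
      using upt_add_eq_append[of 0 "k * s" s] by (simp only: mult_Suc add.commute le0 simp_thms)
    also have "[k * s..<k * s + s] = map (\<lambda>x. k * s + x) [0..<s]"
      by (rule nth_equalityI) simp_all
    finally show ?case by (simp only: Suc upt_Suc le0 if_True map_append concat_append) simp
  qed simp
  have concat_items: "concat (map h [0..<n * s]) =
      concat (map (\<lambda>v. concat (map (\<lambda>x. h (v * s + x)) [0..<s])) [0..<n])" for h :: "nat \<Rightarrow> nat list"
  proof -
    have "concat (map h (concat (map g ks))) = concat (map (\<lambda>v. concat (map h (g v))) ks)"
      for g :: "nat \<Rightarrow> nat list" and ks
      by (induction ks) auto
    then show ?thesis unfolding items by (simp add: o_def)
  qed
  have dims: "map f [1..<2 * D + 1] = map (\<lambda>g. f (Suc g)) [0..<D] @ map (\<lambda>g. f (Suc (D + g))) [0..<D]"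
    for f :: "nat \<Rightarrow> nat"
    by (rule nth_equalityI) (auto simp: nth_append simp del: upt_Suc)
  have costs: "map (cost K (v * s + x)) [1..<2 * D + 1] =
      map (\<lambda>g. low_cost g v x) [0..<D] @ map (\<lambda>g. high_cost g v x) [0..<D]" if "x < s" for v x
    unfolding dims using that item_div_mod[of x v] by (simp add: K_def)
  have dim_K: "dim K = 2 * D" by (simp add: K_def)
  have profit_K: "profit K (v * s + x) = worth v" if "x < s" for v x
    using that item_div_mod[of x v] by (simp add: K_def)
  have budgets: "map (budget K) [1..<2 * D + 1] = map low_budget [0..<D] @ map high_budget [0..<D]"
    unfolding dims by (simp add: K_def)
  have sorted: "sorted_list_of_set (items K) = [0..<n * s]" by (simp add: K_def lessThan_atLeast0)
  show ?thesis
    unfolding knapsack_nums_def Let_def dim_K budgets sorted length_upt concat_items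
    by (auto simp: reduction_stmt_def costs[unfolded mult_2] profit_K mult_2 simp flip: One_nat_def
        simp del: upt_Suc intro!: arg_cong[where f = concat] map_cong)
qed

text \<open>All numbers in the knapsack instance have at most \<open>L\<close> binary digits.\<close>

definition L :: nat where "L = 2 * (T + 1) * bits + s"

lemma L_ge: "T * bits + 2 * T + 2 \<le> L" "2 * m \<le> L" "T * bits \<le> L" "T + s + 1 \<le> L" "2 * T + 2 \<le> L"
  by (simp_all add: L_def bits_def algebra_simps)

lemma bitlen_le_L: "a \<le> 2 * T * W \<Longrightarrow> bitlen a \<le> L"
proof -
  assume "a \<le> 2 * T * W"
  also have "\<dots> < 2 ^ Suc (2 * T) * W"
  proof -
    have "2 * T < 2 ^ (2 * T)" by (rule less_exp)
    then have "2 * T < 2 ^ Suc (2 * T)" by (simp only: power_Suc)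
    then show ?thesis unfolding W_def by (rule mult_strict_right_mono) simp
  qed
  also have "\<dots> = 2 ^ (T * bits + 2 * T + 1)" by (simp add: W_def power_add)
  finally have "bitlen a \<le> T * bits + 2 * T + 1" by (rule bitlen_le) simp
  with L_ge(1) show ?thesis by linarith
qed

lemma inc_le: "inc k v \<le> 2" and cap_le: "cap k \<le> 2"
  by (auto simp: inc_def cap_def)

lemma sum_ingroup_le: "(\<And>k. f k \<le> 2) \<Longrightarrow> (\<Sum>k<T. ingroup g k * f k) \<le> 2 * T"
  by (rule order_trans[OF sum_bounded_above[of _ _ 2]]) (auto simp: ingroup_iff)

lemma bitlen_costs:
  assumes "x < s"
  shows "bitlen (low_cost g v x) \<le> L" "bitlen (high_cost g v x) \<le> L"
proof -
  have "(\<Sum>k<T. ingroup g k * inc k v) * W \<le> 2 * T * W"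
    by (intro mult_right_mono sum_ingroup_le inc_le) simp
  moreover note low_cost_le[OF assms, of g v]
  ultimately have "low_cost g v x \<le> 2 * T * W" "high_cost g v x \<le> 2 * T * W"
    unfolding high_cost_def by linarith+
  then show "bitlen (low_cost g v x) \<le> L" "bitlen (high_cost g v x) \<le> L"
    by (auto intro: bitlen_le_L)
qed

lemma bitlen_budgets: "bitlen (low_budget g) \<le> L" "bitlen (high_budget g) \<le> L"
proof -
  have "(\<Sum>k<T. ingroup g k * cap k) * W \<le> 2 * T * W"
    by (intro mult_right_mono sum_ingroup_le cap_le) simp
  moreover note low_budget_le[of g]
  ultimately have "low_budget g \<le> 2 * T * W" "high_budget g \<le> 2 * T * W"
    unfolding high_budget_def by linarith+
  then show "bitlen (low_budget g) \<le> L" "bitlen (high_budget g) \<le> L"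
    by (auto intro: bitlen_le_L)
qed

lemma bitlen_worth: "bitlen (worth v) \<le> L"
proof (rule bitlen_le_L)
  have "worth v \<le> 2 * T" unfolding worth_def
    by (rule order_trans[OF sum_bounded_above[of _ _ 2]]) (auto simp: inc_le)
  also have "\<dots> \<le> 2 * T * W" by (simp add: W_def)
  finally show "worth v \<le> 2 * T * W" .
qed

lemma bitlen_item: "i \<le> n * s \<Longrightarrow> bitlen i \<le> L"
proof -
  assume "i \<le> n * s"
  also have "\<dots> \<le> T * s" by (simp add: T_def)
  also have "\<dots> < 2 ^ T * 2 ^ s" by (intro mult_strict_mono') auto
  also have "\<dots> \<le> 2 ^ (T + s + 1)" by (simp add: power_add)
  finally have "bitlen i \<le> T + s + 1" by (rule bitlen_le) simp
  with L_ge show ?thesis by linarith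
qed

lemma D_le: "D \<le> T"
  unfolding D_def by (rule order_trans[OF sum_bounded_above[of _ _ 1]]) auto

lemma bitlen_dim: "bitlen (2 * D) \<le> L"
proof -
  have "2 * D < 2 ^ (2 * T + 1)"
  proof -
    have "2 * D \<le> 2 * T" using D_le by simp
    also have "2 * T < 2 ^ (2 * T)" by (rule less_exp)
    finally show ?thesis by simp
  qed
  then have "bitlen (2 * D) \<le> 2 * T + 1" by (rule bitlen_le) simp
  with L_ge show ?thesis by linarith
qed

section \<open>Iteration bounds for the loops of the program\<close>

context
  fixes M assumes M: "L \<le> M"
begin

lemma M_ge: "0 < M" "T * bits \<le> M" "2 * m \<le> M" "2 * T \<le> M" "T \<le> M" "s \<le> M" "D \<le> M" "n \<le> M"
  using M L_ge D_le by (auto simp: T_def)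

lemma loops_le_parameters [simp]:
  "loops_le M inp F_expr env" "loops_le M inp n_expr env" "loops_le M inp E_expr env"
  "loops_le M inp s_expr env" "loops_le M inp m_expr env" "loops_le M inp T_expr env"
  "loops_le M inp bits_expr env" "loops_le M inp table_expr env" "loops_le M inp edge_expr env"
  by (simp_all add: F_expr_def n_expr_def E_expr_def s_expr_def m_expr_def T_expr_def bits_expr_def
      table_expr_def edge_expr_def)

lemma of_bool_le_M [simp]: "of_bool P \<le> M"
  using M_ge(1) by (cases P) auto

lemma loops_le_D [simp]: "loops_le M inp D_expr env"
  using M_ge by (auto simp: D_expr_def)

lemma loops_le_ingroup [simp]: "env 2 < D \<Longrightarrow> loops_le M inp ingroup_expr env"
  using M_ge by (auto simp: ingroup_expr_def)

lemma loops_le_inc [simp]: "env 0 < n \<Longrightarrow> env 3 < T \<Longrightarrow> loops_le M inp inc_expr env"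
  using M_ge by (auto simp: inc_expr_def is_tail_expr_def is_head_expr_def)

lemma loops_le_dig [simp]:
  "env 0 < n \<Longrightarrow> env 3 < T \<Longrightarrow> loops_le M inp dig_expr env"
  using M_ge by (auto simp: dig_expr_def is_tail_expr_def is_head_expr_def row_expr_def)

lemma loops_le_cap [simp]: "loops_le M inp cap_expr env"
  by (simp add: cap_expr_def)

lemma loops_le_tgt [simp]: "loops_le M inp tgt_expr env"
  by (simp add: tgt_expr_def)

lemma ingroup_le_M [simp]: "ingroup g k \<le> M"
  by (simp add: ingroup_iff)

lemma loops_le_group_sum:
  assumes "env 2 < D" "\<And>k. k < T \<Longrightarrow> loops_le M inp e (env(3 := k))"
  shows "loops_le M inp (group_sum_expr e) env"
  using assms M_ge by (simp add: group_sum_expr_def)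

text \<open>\<open>Pow2\<close> makes as many rounds as its exponent says, so exponents up to
  \<open>T * bits\<close> are affordable.\<close>

lemma loops_le_weighted:
  assumes "env 2 < D" "\<And>k. k < T \<Longrightarrow> loops_le M inp e (env(3 := k))"
    and "\<And>k. k < T \<Longrightarrow> eval inp e (env(3 := k)) \<le> 2 * m"
  shows "loops_le M inp (weighted_expr e) env"
proof -
  have "k * bits \<le> M" if "k < T" for k
    using mult_le_mono1[of k T bits] M_ge(2) that by linarith
  moreover have "eval inp e (env(3 := k)) \<le> M" "k \<le> M" if "k < T" for k
    using assms(3)[OF that] M_ge that by linarith+
  ultimately show ?thesis unfolding weighted_expr_def using assms
    by (intro loops_le_group_sum) auto
qed

lemma loops_le_complement:
  assumes "env 2 < D" "\<And>k. k < T \<Longrightarrow> loops_le M inp e (env(3 := k))"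
    and "\<And>k. k < T \<Longrightarrow> eval inp e (env(3 := k)) \<le> 2"
    and "loops_le M inp (weighted_expr f) env"
  shows "loops_le M inp (complement_expr e f) env"
proof -
  have "eval inp (group_sum_expr e) env \<le> 2 * T"
  proof -
    have "eval inp (group_sum_expr e) env \<le> of_nat (card {..<T}) * 2"
      unfolding group_sum_expr_def eval.simps eval_parameters
      by (rule sum_bounded_above) (use assms(3) in \<open>auto simp: ingroup_iff\<close>)
    then show ?thesis by simp
  qed
  then show ?thesis using assms M_ge by (simp add: complement_expr_def loops_le_group_sum)
qed

lemma dig_le_2m: "k < T \<Longrightarrow> x < s \<Longrightarrow> dig k v x \<le> 2 * m"
  using dig_le[of k x v] mult_le_mono1[OF inc_le, of k v m] by linarith

lemma tgt_le_2m: "tgt k \<le> 2 * m"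
  using m by (simp add: tgt_def)

lemma feasible_reduction_stmt: "feasible M inp reduction_stmt env"
proof -
  have le_M: "bitlen i \<le> L \<Longrightarrow> bitlen i \<le> M" for i using M by simp
  have item: "bitlen (v * s + x) \<le> M" if "v < n" "x < s" for v x
  proof -
    have "v * s + x \<le> Suc v * s" using that by simp
    also have "\<dots> \<le> n * s" using that by (intro mult_right_mono) auto
    finally show ?thesis by (intro le_M bitlen_item)
  qed
  have worth: "loops_le M inp worth_expr env" if "env 0 < n" for env
    using that M_ge by (simp add: worth_expr_def)
  have cost: "loops_le M inp (weighted_expr dig_expr) env"
    "loops_le M inp (complement_expr inc_expr dig_expr) env"
    if "env 0 < n" "env (Suc 0) < s" "env 2 < D" for env
    using that by (auto intro!: loops_le_weighted loops_le_complement simp: dig_le_2m inc_le)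
  have budget: "loops_le M inp (weighted_expr tgt_expr) env"
    "loops_le M inp (complement_expr cap_expr tgt_expr) env" if "env 2 < D" for env
    using that by (auto intro!: loops_le_weighted loops_le_complement simp: tgt_le_2m cap_le)
  have "bitlen (D + D) \<le> M" "bitlen (n * s) \<le> M"
    using bitlen_dim bitlen_item[of "n * s"] M by (simp_all add: mult_2)
  then show ?thesis
    using M_ge by (auto simp: reduction_stmt_def item worth cost budget le_M bitlen_worth bitlen_costs bitlen_budgets)
qed

end

end

section \<open>Encoding of R-CSP instances\<close>

lemma length_enc_nums: "length (enc_nums ns) = (\<Sum>x\<leftarrow>ns. bitlen x + 1)"
  by (simp add: enc_nums_def length_concat o_def bitlen_def)

lemma length_enc_nums_le:
  assumes "\<And>x. x \<in> set ns \<Longrightarrow> bitlen x \<le> b"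
  shows "length (enc_nums ns) \<le> length ns * (b + 1)"
proof -
  have "(\<Sum>x\<leftarrow>ns. bitlen x + 1) \<le> (\<Sum>x\<leftarrow>ns. b + 1)"
    using assms by (intro sum_list_mono) simp
  then show ?thesis by (simp add: length_enc_nums sum_list_triv)
qed

lemma length_enc_nums_ge: "2 * length ns \<le> length (enc_nums ns)"
proof -
  have "(\<Sum>x\<leftarrow>ns. 2) \<le> (\<Sum>x\<leftarrow>ns. bitlen x + 1)"
    using bitlen_pos by (intro sum_list_mono) (simp add: Suc_le_eq)
  then show ?thesis by (simp add: length_enc_nums sum_list_triv mult.commute)
qed

text \<open>Feasibility, imposed for the running time, also bounds the digits of the output.\<close>

lemma bitlen_emitted_le:
  "feasible M inp c env \<Longrightarrow> x \<in> set (emitted inp c env) \<Longrightarrow> bitlen x \<le> M"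
  by (induction c arbitrary: env) auto

lemma length_knapsack_nums:
  assumes "finite (items K)"
  shows "length (knapsack_nums K) = 2 + card (items K) * (2 + dim K) + dim K"
  using assms
  by (simp add: knapsack_nums_def Let_def length_concat o_def sum_list_triv algebra_simps del: upt_Suc)

section \<open>Size of the instance and running time\<close>

context encoded_reduction
begin

text \<open>There are \<open>O(N^2)\<close> numbers, since \<open>n * s\<close> and \<open>D\<close>
  are at most \<open>N\<close>, with \<open>O(N^2)\<close> digits each, since \<open>T\<close> and
  \<open>bits\<close> are at most \<open>N\<close>.\<close>

lemma knapsack_size_le:
  assumes N: "n * s \<le> N" "T + m + 1 \<le> N" "s \<le> N"
  shows "knapsack_size K \<le> 12 * N ^ 4"
proof -
  have "bitlen x \<le> L" if "x \<in> set (knapsack_nums K)" for x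
    using bitlen_emitted_le[OF feasible_reduction_stmt[OF order.refl]] that
    by (metis emitted_reduction_stmt)
  then have "knapsack_size K \<le> length (knapsack_nums K) * (L + 1)"
    unfolding knapsack_size_def by (rule length_enc_nums_le)
  also have "length (knapsack_nums K) = 2 + n * s * (2 + 2 * D) + 2 * D"
    by (subst length_knapsack_nums) (simp_all add: K_def)
  also have "\<dots> * (L + 1) \<le> (4 * N ^ 2) * (3 * N ^ 2)"
  proof (rule mult_mono)
    have "n * s * (2 + 2 * D) \<le> N * (2 * N)"
      using N D_le by (intro mult_mono) auto
    moreover have "2 + 2 * D \<le> 2 * N" "2 * N \<le> 2 * (N * N)" using N D_le by auto
    ultimately show "2 + n * s * (2 + 2 * D) + 2 * D \<le> 4 * N ^ 2"
      unfolding power2_eq_square by linarith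
    have "2 * (T + 1) * bits \<le> (2 * N) * N" using N unfolding bits_def by (intro mult_mono) auto
    moreover have "s + 1 \<le> N * N"
    \<comment> \<open>\<open>N = 1\<close> contradicts the bound on \<open>T + m + 1\<close>, as
      \<open>m\<close> is positive; otherwise \<open>2 * N \<le> N * N\<close>.\<close>
    proof (cases "N = 1")
      case True
      then show ?thesis using N m by simp
    next
      case False
      then have "2 \<le> N" using N by simp
      from mult_le_mono1[OF this, of N] have "2 * N \<le> N * N" .
      with \<open>2 \<le> N\<close> N(3) show ?thesis by linarith
    qed
    ultimately show "L + 1 \<le> 3 * N ^ 2" unfolding L_def power2_eq_square by linarith
  qed auto
  finally show ?thesis by (simp add: power_mult_distrib flip: power_add)
qed

lemma L_le:
  assumes N: "T + m + 1 \<le> N" "s \<le> N"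
  shows "L \<le> 3 * N ^ 2"
proof -
  have "2 * (T + 1) * bits \<le> (2 * N) * N" using N unfolding bits_def by (intro mult_mono) auto
  moreover have "N \<le> N * N" by simp
  ultimately show ?thesis using N unfolding L_def power2_eq_square by linarith
qed

end

text \<open>As \<open>N\<close> is at least 2, coefficients are absorbed into powers:
  \<open>8 \<le> N ^ 3\<close>, \<open>K \<le> 2 ^ K \<le> N ^ K\<close> and
  \<open>M + 2 \<le> N ^ 5\<close>. The result is a pure power of \<open>N\<close>.\<close>

lemma time_polynomial:
  fixes N K M :: nat
  assumes "2 \<le> N" "0 < K" "M \<le> 4 * N ^ 2"
  shows "(M + 2) ^ K * ((2 + K * (M + 2) ^ K + K + 1) * K) \<le> N ^ (12 * K + 3)"
proof -
  define y where "y = N ^ (5 * K)"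
  have pow: "2 ^ k \<le> N ^ k" for k using assms(1) by (rule power_mono) simp
  have "M + 2 \<le> 4 * N ^ 2 + 2" using assms by simp
  also have "\<dots> \<le> N ^ 2 * 2 ^ 3" using power_mono[OF assms(1), of 2] by simp
  also have "\<dots> \<le> N ^ 2 * N ^ 3" by (intro mult_left_mono pow) simp
  also have "\<dots> = N ^ 5" by (simp flip: power_add)
  finally have "(M + 2) ^ K \<le> (N ^ 5) ^ K" by (rule power_mono) simp
  then have M: "(M + 2) ^ K \<le> y" by (simp add: y_def power_mult)
  have "K \<le> 2 ^ K" by simp
  also have "\<dots> \<le> N ^ K" by (rule pow)
  finally have K: "K \<le> N ^ K" .
  have y: "1 \<le> y" using assms(1) by (simp add: y_def)
  have "2 + K * (M + 2) ^ K + K + 1 \<le> 2 + K * y + K + 1" using M by simp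
  also have "\<dots> \<le> 8 * (K * y)"
  proof -
    have "1 \<le> K * y" "K \<le> K * y" using y assms(2) by simp_all
    then show ?thesis by linarith
  qed
  also have "\<dots> \<le> N ^ 3 * (N ^ K * y)" using pow[of 3] K by (intro mult_mono) auto
  finally have "2 + K * (M + 2) ^ K + K + 1 \<le> N ^ 3 * (N ^ K * y)" .
  from mult_mono[OF this K] have
    "(2 + K * (M + 2) ^ K + K + 1) * K \<le> N ^ 3 * (N ^ K * y) * N ^ K" by simp
  with M have "(M + 2) ^ K * ((2 + K * (M + 2) ^ K + K + 1) * K) \<le> y * (N ^ 3 * (N ^ K * y) * N ^ K)"
    by (rule mult_mono) auto
  also have "\<dots> = N ^ (5 * K + (3 + (K + 5 * K) + K))" by (simp only: y_def power_add mult.assoc)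
  also have "5 * K + (3 + (K + 5 * K) + K) = 12 * K + 3" by simp
  finally show ?thesis .
qed

section \<open>Positions in the encoding of an instance\<close>

lemma nth0_at: "ns = xs @ ys \<Longrightarrow> i = length xs + j \<Longrightarrow> nth0 ns i = nth0 ys j"
  by (simp add: nth0_def nth_append)

lemma nth0_middle: "ns = xs @ y # ys \<Longrightarrow> i = length xs \<Longrightarrow> nth0 ns i = y"
  by (simp add: nth0_def)

lemma nth0_block:
  assumes "\<And>x. x \<in> set xs \<Longrightarrow> length (f x) = c" "e < length xs" "i < c"
  shows "nth0 (concat (map f xs) @ ys) (e * c + i) = f (xs ! e) ! i"
  using assms
proof (induction xs arbitrary: e)
  case Nil
  then show ?case by simp
next
  case (Cons x xs)
  show ?case
  proof (cases e)
    case 0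
    then show ?thesis using Cons.prems(1)[of x] Cons.prems(3) by (simp add: nth0_def nth_append)
  next
    case (Suc e')
    have "nth0 (concat (map f (x # xs)) @ ys) (e * c + i) = nth0 (concat (map f xs) @ ys) (e' * c + i)"
      by (rule nth0_at[where xs = "f x"]) (use Suc Cons.prems(1)[of x] in auto)
    then show ?thesis using Cons.IH[of e'] Cons.prems Suc by simp
  qed
qed

context
  fixes \<Pi> :: "(nat, nat) rcsp"
begin

text \<open>Indices are positions in the lists that the encoding uses.\<close>

definition vertex :: "nat \<Rightarrow> nat" where "vertex v = sorted_list_of_set (verts \<Pi>) ! v"
definition vertex_index :: "nat \<Rightarrow> nat" where
  "vertex_index = inv_into {..<card (verts \<Pi>)} vertex"
definition symb :: "nat \<Rightarrow> nat" where "symb x = sorted_list_of_set (sigma \<Pi>) ! x"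
definition edge :: "nat \<Rightarrow> nat \<times> nat" where "edge e = edge_list \<Pi> ! e"
definition edge_tail :: "nat \<Rightarrow> nat" where "edge_tail e = vertex_index (fst (edge e))"
definition edge_head :: "nat \<Rightarrow> nat" where "edge_head e = vertex_index (snd (edge e))"
definition tail_map :: "nat \<Rightarrow> nat \<Rightarrow> nat" where
  "tail_map e x = proj \<Pi> (edge e) (fst (edge e)) (symb x)"
definition head_map :: "nat \<Rightarrow> nat \<Rightarrow> nat" where
  "head_map e x = proj \<Pi> (edge e) (snd (edge e)) (symb x)"

end

text \<open>Defined outside the locale, because the reduction has to be a total function of
  \<open>\<Pi>\<close> and \<open>F\<close>.\<close>

definition rcsp_knapsack :: "(nat, nat) rcsp \<Rightarrow> nat \<Rightarrow> nat knapsack" where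
  "rcsp_knapsack \<Pi> F = reduction.K (card (verts \<Pi>)) (card (edges \<Pi>)) F (card (sigma \<Pi>)) (ups \<Pi>)
     (edge_tail \<Pi>) (edge_head \<Pi>) (tail_map \<Pi>) (head_map \<Pi>)"

locale rcsp_instance =
  fixes \<Pi> :: "(nat, nat) rcsp" and F :: nat
  assumes rcsp: "is_rcsp \<Pi>" and F_pos: "0 < F"
begin

abbreviation "n \<equiv> card (verts \<Pi>)"
abbreviation "E \<equiv> card (edges \<Pi>)"
abbreviation "s \<equiv> card (sigma \<Pi>)"
abbreviation "vs \<equiv> sorted_list_of_set (verts \<Pi>)"
abbreviation "xs \<equiv> sorted_list_of_set (sigma \<Pi>)"
abbreviation "es \<equiv> edge_list \<Pi>"

lemma finite_verts: "finite (verts \<Pi>)" and finite_sigma: "finite (sigma \<Pi>)"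
  and ups_pos: "0 < ups \<Pi>"
  and edges_sub: "edges \<Pi> \<subseteq> verts \<Pi> \<times> verts \<Pi>"
  and edge_less: "(u, v) \<in> edges \<Pi> \<Longrightarrow> u < v"
  and proj_le: "(u, v) \<in> edges \<Pi> \<Longrightarrow> x \<in> sigma \<Pi> \<Longrightarrow>
    proj \<Pi> (u, v) u x \<le> ups \<Pi> \<and> proj \<Pi> (u, v) v x \<le> ups \<Pi>"
  using rcsp unfolding is_rcsp_def by fastforce+

lemma finite_edges: "finite (edges \<Pi>)"
  using edges_sub finite_verts by (meson finite_SigmaI finite_subset)

lemma set_es: "set es = edges \<Pi>" and distinct_es: "distinct es"
  using edges_sub finite_verts by (auto simp: edge_list_def Let_def distinct_product)

lemma length_es: "length es = E"
  using distinct_card[OF distinct_es] set_es by simp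

lemma vertex_bij: "bij_betw (vertex \<Pi>) {..<n} (verts \<Pi>)"
  using bij_betw_nth[of vs "{..<n}" "verts \<Pi>"] finite_verts by (simp add: vertex_def[abs_def])

lemma symb_bij: "bij_betw (symb \<Pi>) {..<s} (sigma \<Pi>)"
  using bij_betw_nth[of xs "{..<s}" "sigma \<Pi>"] finite_sigma by (simp add: symb_def[abs_def])

lemma vertex_inj: "inj_on (vertex \<Pi>) {..<n}" and vertex_image: "vertex \<Pi> ` {..<n} = verts \<Pi>"
  using vertex_bij by (auto simp: bij_betw_def)

lemma vertex_index:
  assumes "u \<in> verts \<Pi>"
  shows "vertex_index \<Pi> u < n" "vertex \<Pi> (vertex_index \<Pi> u) = u"
proof -
  have u: "u \<in> vertex \<Pi> ` {..<n}" using vertex_image assms by simp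
  show "vertex_index \<Pi> u < n" using inv_into_into[OF u] by (simp add: vertex_index_def)
  show "vertex \<Pi> (vertex_index \<Pi> u) = u" using f_inv_into_f[OF u] by (simp add: vertex_index_def)
qed

lemma edge_mem: "e < E \<Longrightarrow> edge \<Pi> e \<in> edges \<Pi>"
  using set_es length_es by (metis edge_def nth_mem)

lemma edge_ends: "e < E \<Longrightarrow> fst (edge \<Pi> e) \<in> verts \<Pi>" "e < E \<Longrightarrow> snd (edge \<Pi> e) \<in> verts \<Pi>"
  using edge_mem edges_sub by (metis mem_Times_iff subsetD)+

lemma vertex_edge_tail: "e < E \<Longrightarrow> vertex \<Pi> (edge_tail \<Pi> e) = fst (edge \<Pi> e)"
  and vertex_edge_head: "e < E \<Longrightarrow> vertex \<Pi> (edge_head \<Pi> e) = snd (edge \<Pi> e)"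
  using vertex_index edge_ends by (auto simp: edge_tail_def edge_head_def)

lemma symb_mem: "x < s \<Longrightarrow> symb \<Pi> x \<in> sigma \<Pi>"
  using symb_bij by (auto simp: bij_betw_def)

lemma rcsp_nums_eq:
  "rcsp_nums \<Pi> = n # vs @ E # concat (map (\<lambda>e. [fst e, snd e]) es) @ s # xs @
     ups \<Pi> # [1..<ups \<Pi> + 1] @
     concat (map (\<lambda>e. map (proj \<Pi> e (fst e)) xs @ map (proj \<Pi> e (snd e)) xs) es)"
  by (simp add: rcsp_nums_def Let_def with_length_def length_es case_prod_unfold del: upt_Suc)

lemma length_ends: "length (concat (map (\<lambda>e. [fst e, snd e]) ys)) = 2 * length ys"
  by (induction ys) auto

lemma length_rcsp_nums: "length (rcsp_nums \<Pi>) = 4 + n + 2 * E + s + ups \<Pi> + E * (2 * s)"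
proof -
  have "length (concat (map (\<lambda>e. map (proj \<Pi> e (fst e)) xs @ map (proj \<Pi> e (snd e)) xs) ys)) =
    length ys * (2 * s)" for ys :: "(nat \<times> nat) list"
    by (induction ys) auto
  then show ?thesis unfolding rcsp_nums_eq by (simp add: length_ends length_es del: upt_Suc)
qed

text \<open>The positions assumed in \<open>encoded_reduction\<close> are those of
  \<open>rcsp_nums\<close>, shifted by one as \<open>F\<close> comes first.\<close>

sublocale encoded_reduction n E F s "ups \<Pi>" "edge_tail \<Pi>" "edge_head \<Pi>" "tail_map \<Pi>" "head_map \<Pi>"
  "nth0 (F # rcsp_nums \<Pi>)"
proof
  show "0 < F" "0 < ups \<Pi>" by (fact F_pos ups_pos)+
  fix e assume e: "e < E"
  show "edge_tail \<Pi> e < n" "edge_head \<Pi> e < n"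
    using vertex_index edge_ends e by (simp_all add: edge_tail_def edge_head_def)
  show "edge_tail \<Pi> e \<noteq> edge_head \<Pi> e"
    using edge_less[of "fst (edge \<Pi> e)" "snd (edge \<Pi> e)"] edge_mem[OF e]
      vertex_edge_tail[OF e] vertex_edge_head[OF e] by (metis less_irrefl prod.collapse)
  fix x assume x: "x < s"
  show "tail_map \<Pi> e x \<le> ups \<Pi>" "head_map \<Pi> e x \<le> ups \<Pi>"
    using proj_le[of "fst (edge \<Pi> e)" "snd (edge \<Pi> e)", OF _ symb_mem[OF x]] edge_mem[OF e]
    by (simp_all add: tail_map_def head_map_def)
next
  let ?inp = "nth0 (F # rcsp_nums \<Pi>)"
  let ?ends = "concat (map (\<lambda>e. [fst e, snd e]) es)"
  let ?tables = "concat (map (\<lambda>e. map (proj \<Pi> e (fst e)) xs @ map (proj \<Pi> e (snd e)) xs) es)"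
  have name: "?inp (v + 2) = vertex \<Pi> v" if "v < n" for v
    using that nth0_at[of "F # rcsp_nums \<Pi>" "[F, n]" _ "v + 2" v] unfolding rcsp_nums_eq
    by (simp add: nth0_def nth_append vertex_def)
  show "?inp 0 = F" by (simp add: nth0_def)
  show "?inp (Suc 0) = n" unfolding rcsp_nums_eq by (simp add: nth0_def)
  show "inj_on (\<lambda>v. ?inp (v + 2)) {..<n}"
    using vertex_inj name by (simp add: inj_on_def)
  show "?inp (n + 2) = E"
    unfolding rcsp_nums_eq
    by (rule nth0_middle[where xs = "F # n # vs"]) (simp_all del: upt_Suc)
  show "?inp (n + 3 + (E + E)) = s"
    unfolding rcsp_nums_eq
    by (rule nth0_middle[where xs = "F # n # vs @ E # ?ends"])
      (simp_all add: length_ends length_es del: upt_Suc)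
  show "?inp (n + 4 + (E + E) + s) = ups \<Pi>"
    unfolding rcsp_nums_eq
    by (rule nth0_middle[where xs = "F # n # vs @ E # ?ends @ s # xs"])
      (simp_all add: length_ends length_es del: upt_Suc)
  fix e assume e: "e < E"
  have ends: "?inp (n + 3 + (e * 2 + i)) = [fst (edge \<Pi> e), snd (edge \<Pi> e)] ! i" if "i < 2" for i
  proof -
    have "?inp (n + 3 + (e * 2 + i)) =
      nth0 (?ends @ s # xs @ ups \<Pi> # [1..<ups \<Pi> + 1] @ ?tables) (e * 2 + i)"
      unfolding rcsp_nums_eq
      by (rule nth0_at[where xs = "F # n # vs @ [E]"]) (simp_all del: upt_Suc)
    also have "\<dots> = [fst (es ! e), snd (es ! e)] ! i"
      by (rule nth0_block) (use e that in \<open>simp_all add: length_es\<close>)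
    finally show ?thesis by (simp add: edge_def)
  qed
  show "?inp (n + 3 + (e + e)) = ?inp (edge_tail \<Pi> e + 2)"
    using ends[of 0] name[of "edge_tail \<Pi> e"] vertex_index(1)[OF edge_ends(1)[OF e]]
      vertex_edge_tail[OF e]
    by (simp add: edge_tail_def mult_2_right)
  have shift: "n + 4 + (e + e) = n + 3 + (e * 2 + 1)" by simp
  show "?inp (n + 4 + (e + e)) = ?inp (edge_head \<Pi> e + 2)"
    unfolding shift
    using ends[of 1] name[of "edge_head \<Pi> e"] vertex_index(1)[OF edge_ends(2)[OF e]]
      vertex_edge_head[OF e]
    by (simp add: edge_head_def)
  have table: "?inp (n + 5 + (E + E) + s + ups \<Pi> + (e * (s + s) + i)) =
    (map (proj \<Pi> (edge \<Pi> e) (fst (edge \<Pi> e))) xs @ map (proj \<Pi> (edge \<Pi> e) (snd (edge \<Pi> e))) xs) ! i"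
    if "i < s + s" for i
  proof -
    have "?inp (n + 5 + (E + E) + s + ups \<Pi> + (e * (s + s) + i)) =
      nth0 (?tables @ []) (e * (s + s) + i)"
      unfolding rcsp_nums_eq
      by (rule nth0_at[where xs = "F # n # vs @ E # ?ends @ s # xs @ ups \<Pi> # [1..<ups \<Pi> + 1]"])
        (simp_all add: length_ends length_es del: upt_Suc)
    also have "\<dots> = (map (proj \<Pi> (es ! e) (fst (es ! e))) xs @
        map (proj \<Pi> (es ! e) (snd (es ! e))) xs) ! i"
      by (rule nth0_block) (use e that in \<open>simp_all add: length_es\<close>)
    finally show ?thesis by (simp add: edge_def)
  qed
  fix x assume x: "x < s"
  show "?inp (n + 5 + (E + E) + s + ups \<Pi> + e * (s + s) + x) = tail_map \<Pi> e x"
    using table[of x] x by (simp add: tail_map_def symb_def nth_append add.assoc)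
  show "?inp (n + 5 + (E + E) + s + ups \<Pi> + e * (s + s) + s + x) = head_map \<Pi> e x"
    using table[of "s + x"] x by (simp add: head_map_def symb_def nth_append add.assoc)
qed

lemma rcsp_knapsack_eq: "rcsp_knapsack \<Pi> F = K"
  by (simp add: rcsp_knapsack_def)

section \<open>Partial assignments and solutions\<close>

lemma sizes_finite: "finite {card (dom \<phi>) | \<phi>. partial_assignment \<Pi> \<phi> \<and> consistent \<Pi> \<phi>}"
proof (rule finite_subset)
  show "{card (dom \<phi>) | \<phi>. partial_assignment \<Pi> \<phi> \<and> consistent \<Pi> \<phi>} \<subseteq> {..n}"
    using card_mono[OF finite_verts] by (auto simp: partial_assignment_def)
qed simp

lemma card_dom_le_Par: "partial_assignment \<Pi> \<phi> \<Longrightarrow> consistent \<Pi> \<phi> \<Longrightarrow> card (dom \<phi>) \<le> Par \<Pi>"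
  unfolding Par_def by (rule Max_ge[OF sizes_finite]) blast

lemma ex_Par: "\<exists>\<phi>. partial_assignment \<Pi> \<phi> \<and> consistent \<Pi> \<phi> \<and> card (dom \<phi>) = Par \<Pi>"
proof -
  have "partial_assignment \<Pi> Map.empty" "consistent \<Pi> Map.empty"
    by (auto simp: partial_assignment_def consistent_def)
  then have "{card (dom \<phi>) | \<phi>. partial_assignment \<Pi> \<phi> \<and> consistent \<Pi> \<phi>} \<noteq> {}" by blast
  from Max_in[OF sizes_finite this] show ?thesis unfolding Par_def by auto
qed

lemma solution_of_Par:
  assumes "Par \<Pi> = n"
  shows "\<exists>S. is_solution K S \<and> total_profit K S = n + 2 * E"
proof -
  obtain \<phi> where \<phi>: "partial_assignment \<Pi> \<phi>" "consistent \<Pi> \<phi>" "card (dom \<phi>) = n"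
    using ex_Par assms by auto
  then have dom: "dom \<phi> = verts \<Pi>"
    using card_subset_eq[OF finite_verts] by (simp add: partial_assignment_def)
  have "\<exists>x<s. \<phi> (vertex \<Pi> v) = Some (symb \<Pi> x)" if "v < n" for v
  proof -
    have "vertex \<Pi> v \<in> dom \<phi>" using dom vertex_image that by blast
    then obtain a where a: "\<phi> (vertex \<Pi> v) = Some a" by blast
    then have "a \<in> sigma \<Pi>" using \<phi>(1) by (auto simp: partial_assignment_def intro: ranI)
    then show ?thesis using a symb_bij by (auto simp: bij_betw_def)
  qed
  then obtain f where f: "\<And>v. v < n \<Longrightarrow> f v < s" "\<And>v. v < n \<Longrightarrow> \<phi> (vertex \<Pi> v) = Some (symb \<Pi> (f v))"
    by metis
  have "tail_map \<Pi> e (f (edge_tail \<Pi> e)) = head_map \<Pi> e (f (edge_head \<Pi> e))" if e: "e < E" for e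
    using \<phi>(2) edge_mem[OF e] f(2)[OF tail[OF e]] f(2)[OF head[OF e]]
      vertex_edge_tail[OF e] vertex_edge_head[OF e]
    unfolding consistent_def tail_map_def head_map_def by (cases "edge \<Pi> e") fastforce
  with f(1) show ?thesis by (rule completeness)
qed

lemma Par_of_solution:
  assumes "is_solution K S" "n + 2 * E \<le> total_profit K S + r"
  shows "n \<le> Par \<Pi> + r * F"
proof -
  obtain R f where R: "R \<subseteq> {..<n}" "n \<le> card R + r * F" and f: "\<And>v. v \<in> R \<Longrightarrow> f v < s"
    and eq: "\<And>e. e < E \<Longrightarrow> edge_tail \<Pi> e \<in> R \<Longrightarrow> edge_head \<Pi> e \<in> R \<Longrightarrow>
      tail_map \<Pi> e (f (edge_tail \<Pi> e)) = head_map \<Pi> e (f (edge_head \<Pi> e))"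
    using soundness[OF assms] by blast
  define \<phi> where "\<phi> u = (if u \<in> vertex \<Pi> ` R then Some (symb \<Pi> (f (vertex_index \<Pi> u))) else None)" for u
  have index: "vertex_index \<Pi> (vertex \<Pi> v) = v" if "v < n" for v
    unfolding vertex_index_def using that vertex_inj by (simp add: inv_into_f_f)
  have mem: "u \<in> verts \<Pi> \<and> vertex_index \<Pi> u \<in> R" if "\<phi> u \<noteq> None" for u
    using that R(1) vertex_image index unfolding \<phi>_def by (fastforce split: if_splits)
  have "partial_assignment \<Pi> \<phi>"
    unfolding partial_assignment_def
  proof (intro conjI subsetI)
    show "u \<in> verts \<Pi>" if "u \<in> dom \<phi>" for u using mem[of u] that by blast
    show "a \<in> sigma \<Pi>" if a: "a \<in> ran \<phi>" for a
    proof -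
      obtain u where u: "\<phi> u = Some a" using a by (auto simp: ran_def)
      then have "a = symb \<Pi> (f (vertex_index \<Pi> u))" by (auto simp: \<phi>_def split: if_splits)
      moreover have "vertex_index \<Pi> u \<in> R" using mem[of u] u by simp
      ultimately show ?thesis using symb_mem f by simp
    qed
  qed
  moreover have "consistent \<Pi> \<phi>"
    unfolding consistent_def
  proof (intro ballI, clarify)
    fix u v a b assume uv: "(u, v) \<in> edges \<Pi>" and ab: "\<phi> u = Some a" "\<phi> v = Some b"
    obtain e where e: "e < E" "edge \<Pi> e = (u, v)"
      using uv set_es length_es by (metis edge_def in_set_conv_nth)
    have "a = symb \<Pi> (f (edge_tail \<Pi> e))" "b = symb \<Pi> (f (edge_head \<Pi> e))"
      using ab e by (auto simp: \<phi>_def edge_tail_def edge_head_def split: if_splits)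
    moreover have "edge_tail \<Pi> e \<in> R" "edge_head \<Pi> e \<in> R"
      using mem[of u] mem[of v] ab e by (auto simp: edge_tail_def edge_head_def)
    ultimately show "proj \<Pi> (u, v) u (the (\<phi> u)) = proj \<Pi> (u, v) v (the (\<phi> v))"
      using eq[OF e(1)] e(2) ab by (simp add: tail_map_def head_map_def)
  qed
  moreover have "dom \<phi> = vertex \<Pi> ` R" by (auto simp: \<phi>_def split: if_splits)
  then have "card (dom \<phi>) = card R"
    using card_image inj_on_subset[OF vertex_inj R(1)] by metis
  ultimately show ?thesis using card_dom_le_Par[of \<phi>] R(2) by simp
qed

text \<open>The alphabets are listed explicitly, so \<open>ups \<Pi>\<close> itself and not only its
  logarithm is bounded by the encoding size; this permits \<open>bits\<close> to be linear in it.
  The tables account for \<open>E * (2 * s)\<close>.\<close>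

lemma size_bounds:
  shows "T + ups \<Pi> + 1 \<le> rcsp_size \<Pi>" "s \<le> rcsp_size \<Pi>" "n + 1 \<le> rcsp_size \<Pi>" "2 \<le> rcsp_size \<Pi>"
    and "E * (2 * s) \<le> rcsp_size \<Pi>"
  using length_enc_nums_ge[of "rcsp_nums \<Pi>"] unfolding rcsp_size_def length_rcsp_nums T_def
  by simp_all

lemma computes_reduction:
  assumes "F \<le> n"
  shows "computes_reduction_within (program reduction_stmt) \<Pi> F K
    (rcsp_size \<Pi> ^ (12 * csize (program reduction_stmt) + 3))"
proof -
  \<comment> \<open>\<open>?M\<close> dominates both \<open>L\<close>, which bounds the loops of the
    statement, and the input length, which bounds the parsing loop.\<close>
  let ?N = "rcsp_size \<Pi>" and ?K = "csize (program reduction_stmt)" and ?M = "4 * rcsp_size \<Pi> ^ 2"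
  have L: "L \<le> ?M" using L_le[OF size_bounds(1,2)] by simp
  \<comment> \<open>\<open>F\<close> is not part of \<open>\<Pi>\<close>, but as it is at most
    \<open>n\<close>, its encoding is bounded by the size of \<open>\<Pi>\<close>.\<close>
  have "bitlen F \<le> F" using F_pos by (intro bitlen_le) auto
  then have "length (enc_nums (F # rcsp_nums \<Pi>)) \<le> n + 1 + ?N"
    using assms by (simp add: length_enc_nums rcsp_size_def)
  also have "\<dots> \<le> 4 * (?N * ?N)"
    using size_bounds(3) le_square[of ?N] by linarith
  finally have len: "length (enc_nums (F # rcsp_nums \<Pi>)) \<le> ?M" by (simp add: power2_eq_square)
  have "computes_within (program reduction_stmt) (enc_nums (F # rcsp_nums \<Pi>))
    (enc_nums (knapsack_nums K)) ((?M + 2) ^ ?K * ((2 + ?K * (?M + 2) ^ ?K + ?K + 1) * ?K))"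
    using computes_within_program[OF len feasible_reduction_stmt[OF L] refl]
    unfolding emitted_reduction_stmt .
  moreover have "(?M + 2) ^ ?K * ((2 + ?K * (?M + 2) ^ ?K + ?K + 1) * ?K) \<le> ?N ^ (12 * ?K + 3)"
    using time_polynomial[OF size_bounds(4) csize_pos order.refl] .
  ultimately show ?thesis
    unfolding computes_reduction_within_def computes_within_def by (meson order_trans)
qed

text \<open>A 3-regular graph has no isolated vertices, so every vertex is an end of some
  edge.\<close>

lemma verts_le_edges:
  assumes "regular 3 \<Pi>"
  shows "n \<le> 2 * E"
proof -
  have "verts \<Pi> \<subseteq> fst ` edges \<Pi> \<union> snd ` edges \<Pi>"
  proof
    fix v assume "v \<in> verts \<Pi>"
    then have "card (neighbours \<Pi> v) = 3" using assms by (simp add: regular_def)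
    then obtain u where "u \<in> neighbours \<Pi> v" by fastforce
    then show "v \<in> fst ` edges \<Pi> \<union> snd ` edges \<Pi>" by (force simp: neighbours_def)
  qed
  then have "n \<le> card (fst ` edges \<Pi> \<union> snd ` edges \<Pi>)"
    using finite_edges by (intro card_mono) auto
  also have "\<dots> \<le> card (fst ` edges \<Pi>) + card (snd ` edges \<Pi>)" by (rule card_Un_le)
  also have "\<dots> \<le> E + E" using finite_edges by (intro add_mono card_image_le)
  finally show ?thesis by simp
qed

text \<open>The number \<open>n * s\<close> of items is at most the number
  \<open>E * (2 * s)\<close> of table entries, hence linear in the input size; this keeps the
  exponent at 4.\<close>

lemma rcsp_knapsack_size:
  assumes "regular 3 \<Pi>"
  shows "knapsack_size K \<le> 12 * rcsp_size \<Pi> ^ 4"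
proof (rule knapsack_size_le)
  have "n * s \<le> 2 * E * s" using verts_le_edges[OF assms] by (rule mult_right_mono) simp
  also have "\<dots> \<le> rcsp_size \<Pi>" using size_bounds(5) by (simp add: mult.assoc mult.left_commute)
  finally show "n * s \<le> rcsp_size \<Pi>" .
qed (fact size_bounds)+

end

theorem lemma4p1:
  "\<exists>(red :: (nat, nat) rcsp \<Rightarrow> nat \<Rightarrow> nat knapsack) (prog :: com) (k :: nat) (C :: nat).
     \<forall>(\<Pi> :: (nat, nat) rcsp) (F :: nat).
       is_rcsp \<Pi> \<and> regular 3 \<Pi> \<and> F \<in> {1..card (verts \<Pi>)} \<longrightarrow>
         is_knapsack (red \<Pi> F) \<and>
         computes_reduction_within prog \<Pi> F (red \<Pi> F) (rcsp_size \<Pi> ^ k) \<and>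
         dim (red \<Pi> F) =
           2 * nat \<lceil>real (card (verts \<Pi>) + card (edges \<Pi>)) / real F\<rceil> \<and>
         knapsack_size (red \<Pi> F) \<le> C * rcsp_size \<Pi> ^ 4 \<and>
         (Par \<Pi> = card (verts \<Pi>) \<longrightarrow>
            (\<exists>S. is_solution (red \<Pi> F) S \<and>
                 total_profit (red \<Pi> F) S = card (verts \<Pi>) + 2 * card (edges \<Pi>))) \<and>
         (\<forall>q :: nat.
            (\<exists>S. is_solution (red \<Pi> F) S \<and>
                 int (total_profit (red \<Pi> F) S)
                   \<ge> int (card (verts \<Pi>)) + 2 * int (card (edges \<Pi>)) - int q) \<longrightarrow>
            int (Par \<Pi>) \<ge> int (card (verts \<Pi>)) - 2 * int q * int F)"
proof (intro exI allI impI)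
  fix \<Pi> :: "(nat, nat) rcsp" and F :: nat
  assume A: "is_rcsp \<Pi> \<and> regular 3 \<Pi> \<and> F \<in> {1..card (verts \<Pi>)}"
  then interpret rcsp_instance \<Pi> F by unfold_locales auto
  have sound: "int (Par \<Pi>) \<ge> int n - 2 * int r * int F"
    if "is_solution K S" "int (total_profit K S) \<ge> int n + 2 * int E - int r" for S r
  proof -
    have "n \<le> Par \<Pi> + r * F" using that by (intro Par_of_solution[of S]) linarith+
    then have "int n \<le> int (Par \<Pi>) + int r * int F"
      unfolding of_nat_mult[symmetric] of_nat_add[symmetric] of_nat_le_iff .
    \<comment> \<open>The loss \<open>r * F\<close> obtained is half of the permitted one.\<close>
    moreover have "0 \<le> int r * int F" by simp
    ultimately show ?thesis by linarith
  qed
  have "is_knapsack K" by (simp add: is_knapsack_def K_def)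
  moreover have "dim K = 2 * nat \<lceil>real (n + E) / real F\<rceil>"
    using D_ceiling by (simp add: K_def T_def)
  ultimately show "is_knapsack (rcsp_knapsack \<Pi> F) \<and>
      computes_reduction_within (program reduction_stmt) \<Pi> F (rcsp_knapsack \<Pi> F)
        (rcsp_size \<Pi> ^ (12 * csize (program reduction_stmt) + 3)) \<and>
      dim (rcsp_knapsack \<Pi> F) = 2 * nat \<lceil>real (n + E) / real F\<rceil> \<and>
      knapsack_size (rcsp_knapsack \<Pi> F) \<le> 12 * rcsp_size \<Pi> ^ 4 \<and>
      (Par \<Pi> = n \<longrightarrow> (\<exists>S. is_solution (rcsp_knapsack \<Pi> F) S \<and>
         total_profit (rcsp_knapsack \<Pi> F) S = n + 2 * E)) \<and>
      (\<forall>q. (\<exists>S. is_solution (rcsp_knapsack \<Pi> F) S \<and>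
         int (total_profit (rcsp_knapsack \<Pi> F) S) \<ge> int n + 2 * int E - int q) \<longrightarrow>
         int (Par \<Pi>) \<ge> int n - 2 * int q * int F)"
    unfolding rcsp_knapsack_eq
    using A computes_reduction rcsp_knapsack_size solution_of_Par sound by auto
qed

end
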